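(* Let $n\ge3$ and let $(\mathbb{B}^n,g)$ be the Euclidean unit ball. For $\bar g=u^{\frac{4}{n-2}}g\in[g]$ with $u$ a positive smooth function on $\mathbb{B}^n$, put $$\overline{\sigma}_1(\mathbb{B}^n,[g],B_{\bar g})=\sigma_1(\mathbb{B}^n,B_{\bar g})\int_{\mathbb{S}^{n-1}}u^{\frac{2}{n-2}}\,da_g,\qquad \sigma_1^*(\mathbb{B}^n,B_g)=\sup_{\bar g\in[g]}\overline{\sigma}_1(\mathbb{B}^n,[g],B_{\bar g}).$$ Then $$\sigma_1^*(\mathbb{B}^n,B_g)=\overline{\sigma}_1(\mathbb{B}^n,[g],B_g).$$ Moreover, if for some metric $\bar g\in[g]$ one has $\sigma_1^*(\mathbb{B}^n,B_g)=\overline{\sigma}_1(\mathbb{B}^n,[g],B_{\bar g})$, then $\bar g$ coincides with the Euclidean metric up to multiplication by a positive constant.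
   Context: For a compact Riemannian manifold $(M^n,g)$ with boundary, $n\ge3$, let $L_g u=-\Delta_g u+c_nR_g u$ with $c_n=\frac{n-2}{4(n-1)}$ (conformal Laplacian, $R_g$ the scalar curvature) and $B_g u=\frac{\partial u}{\partial\eta_g}+b_nH_g u$ on $\partial M$ with $b_n=\frac{n-2}{2}$, where $\eta_g$ is the outward unit normal and $H_g$ is the mean curvature of $\partial M$, normalized as the average of the principal curvatures (so $H_g=1$ for the unit sphere bounding the Euclidean unit ball). With this normalization, for $\bar g=u^{4/(n-2)}g$ one has $R_{\bar g}=c_n^{-1}u^{-\frac{n+2}{n-2}}L_gu$ and $H_{\bar g}=b_n^{-1}u^{-\frac{n}{n-2}}B_gu$. $\sigma_1(M,B_g)$ is the first (smallest) eigenvalue of the conformal Dirichlet-to-Robin problem $L_gu=0$ in $M$, $B_gu=\sigma u$ on $\partial M$. When the first Dirichlet eigenvalue of $L_g$ is positive (which is the case for every metric conformal to the Euclidean metric on the ball), it is the infimum of $$\frac{\int_M(|\nabla u|^2+c_nR_gu^2)\,dv_g+b_n\int_{\partial M}H_gu^2\,da_g}{\int_{\partial M}u^2\,da_g}$$ over $u\in H^1(M)$ with nonzero trace on $\partial M$.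
   Formalization: The rigidity clause is false as stated (σ₁ sees only u on the sphere, so changing u inside the ball keeps equality); what is proved is that ḡ is a positive constant multiple of the Euclidean metric on the boundary sphere, and on the whole ball if ḡ is scalar flat. *)

theory Defs
  imports "HOL-Analysis.Analysis"
begin

section \<open>Smooth functions on the closed unit ball\<close>

definition pd :: "'n::finite \<Rightarrow> (real^'n \<Rightarrow> real) \<Rightarrow> real^'n \<Rightarrow> real" where
  "pd i f x = frechet_derivative f (at x) (axis i 1)"

definition grad :: "(real^'n::finite \<Rightarrow> real) \<Rightarrow> real^'n \<Rightarrow> real^'n" where
  "grad f x = (\<chi> i. pd i f x)"

primrec Ck_on :: "nat \<Rightarrow> (real^'n::finite) set \<Rightarrow> (real^'n \<Rightarrow> real) \<Rightarrow> bool" where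
  "Ck_on 0 U f \<longleftrightarrow> continuous_on U f"
| "Ck_on (Suc k) U f \<longleftrightarrow> f differentiable_on U \<and> (\<forall>i. Ck_on k U (pd i f))"

text \<open>Smoothness up to the boundary, in the usual sense of smoothness on a closed set: being
  smooth on an open neighbourhood. All derivatives at points of the closed ball are
  determined by the values on the closed ball.\<close>

definition smooth_on_cball :: "(real^'n::finite \<Rightarrow> real) \<Rightarrow> bool" where
  "smooth_on_cball f \<longleftrightarrow> (\<exists>U. open U \<and> cball 0 1 \<subseteq> U \<and> (\<forall>k. Ck_on k U f))"


section \<open>Riemannian metrics on the closed unit ball\<close>

text \<open>A metric is given by its matrix in the standard coordinates.\<close>

type_synonym 'n metric = "real^'n \<Rightarrow> real^'n^'n"

definition christoffel :: "('n::finite) metric \<Rightarrow> 'n \<Rightarrow> 'n \<Rightarrow> 'n \<Rightarrow> real^'n \<Rightarrow> real" where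
  "christoffel G k i j x = (1/2) * (\<Sum>l\<in>UNIV. matrix_inv (G x) $ k $ l *
     (pd i (\<lambda>y. G y $ j $ l) x + pd j (\<lambda>y. G y $ i $ l) x - pd l (\<lambda>y. G y $ i $ j) x))"

text \<open>The sign is such that round spheres have positive Ricci curvature.\<close>

definition ricci :: "('n::finite) metric \<Rightarrow> 'n \<Rightarrow> 'n \<Rightarrow> real^'n \<Rightarrow> real" where
  "ricci G i j x = (\<Sum>k\<in>UNIV.
      pd k (christoffel G k i j) x - pd j (christoffel G k i k) x
      + (\<Sum>l\<in>UNIV. christoffel G k k l x * christoffel G l i j x
                    - christoffel G k j l x * christoffel G l i k x))"

definition scalar_curvature :: "('n::finite) metric \<Rightarrow> real^'n \<Rightarrow> real" where
  "scalar_curvature G x = (\<Sum>i\<in>UNIV. \<Sum>j\<in>UNIV. matrix_inv (G x) $ i $ j * ricci G i j x)"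

text \<open>Squared length of the covector with components \<open>\<xi>\<close>; for \<open>\<xi> = grad w x\<close> it is the
  squared length of the Riemannian gradient of \<open>w\<close>.\<close>

definition conorm2 :: "('n::finite) metric \<Rightarrow> real^'n \<Rightarrow> real^'n \<Rightarrow> real" where
  "conorm2 G x \<xi> = \<xi> \<bullet> (matrix_inv (G x) *v \<xi>)"

text \<open>Unit normal of the level sets of \<open>norm\<close>, pointing outwards: the Riemannian gradient of
  \<open>norm x ^ 2 / 2\<close>, normalised. On the unit sphere it is the outward unit normal; off the
  origin it is a unit length extension of it.\<close>

definition outer_normal :: "('n::finite) metric \<Rightarrow> real^'n \<Rightarrow> real^'n" where
  "outer_normal G x = (1 / sqrt (conorm2 G x x)) *\<^sub>R (matrix_inv (G x) *v x)"

text \<open>The components of the covariant derivative \<open>\<nabla>\<^sub>i \<eta>\<^sup>k\<close> of the outer normal. As \<open>\<eta>\<close> has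
  unit length, \<open>\<nabla>\<^sub>X \<eta>\<close> is orthogonal to \<open>\<eta>\<close> for every \<open>X\<close>, hence the trace of
  \<open>X \<mapsto> \<nabla>\<^sub>X \<eta>\<close> over the whole tangent space is the trace of its restriction to the tangent space
  of the sphere, the shape operator, that is, the sum of the principal curvatures.\<close>

definition normal_cov_deriv :: "('n::finite) metric \<Rightarrow> 'n \<Rightarrow> 'n \<Rightarrow> real^'n \<Rightarrow> real" where
  "normal_cov_deriv G i k x = pd i (\<lambda>y. outer_normal G y $ k) x
     + (\<Sum>j\<in>UNIV. christoffel G k i j x * outer_normal G x $ j)"

definition mean_curvature :: "('n::finite) metric \<Rightarrow> real^'n \<Rightarrow> real" where
  "mean_curvature G x = (\<Sum>i\<in>UNIV. normal_cov_deriv G i i x) / (real CARD('n) - 1)"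


section \<open>Volume and area\<close>

text \<open>Euclidean surface measure of the unit sphere: the area of \<open>A\<close> is \<open>n\<close> times the volume of
  the cone \<open>{r *\<^sub>R y | 0 < r < 1, y \<in> A}\<close>, i.e. of the part of the unit ball
  that the radial projection \<open>sgn\<close> sends to \<open>A\<close>. It is a measure on the whole space
  concentrated on the sphere; integrals are nevertheless written over \<open>sphere 0 1\<close>, since
  functions that matter on the closed ball only need not be measurable elsewhere.\<close>

definition sphere_measure :: "(real^'n::finite) measure" where
  "sphere_measure =
     distr (scale_measure (of_nat CARD('n)) (restrict_space lborel (ball 0 1))) borel sgn"

definition vol_density :: "('n::finite) metric \<Rightarrow> real^'n \<Rightarrow> real" where
  "vol_density G x = sqrt (det (G x))"

text \<open>Density of the measure induced by \<open>G\<close> on the unit sphere with respect to the Euclidean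
  surface measure: for a hypersurface with Euclidean unit normal \<open>\<nu>\<close> (here \<open>\<nu> = x\<close>) the
  determinant of the induced metric is \<open>det G * conorm2 G x \<nu>\<close>.\<close>

definition area_density :: "('n::finite) metric \<Rightarrow> real^'n \<Rightarrow> real" where
  "area_density G x = sqrt (det (G x) * conorm2 G x x)"


section \<open>First eigenvalue of the conformal Dirichlet-to-Robin problem\<close>

text \<open>\<open>H1_with_trace w F t\<close>: \<open>w\<close> is in \<open>H\<^sup>1\<close> of the ball, with weak gradient \<open>F\<close> and
  boundary trace \<open>t\<close>. Here \<open>H\<^sup>1\<close> is the completion of the functions smooth up to the boundary,
  and the trace is the continuous extension of the restriction to the sphere; \<open>F\<close> and \<open>t\<close> are
  determined by \<open>w\<close> almost everywhere. The norms of all metrics on the closed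
  ball being equivalent, the Euclidean one is used.\<close>

definition H1_with_trace ::
  "(real^'n::finite \<Rightarrow> real) \<Rightarrow> (real^'n \<Rightarrow> real^'n) \<Rightarrow> (real^'n \<Rightarrow> real) \<Rightarrow> bool" where
  "H1_with_trace w F t \<longleftrightarrow>
     w \<in> borel_measurable borel \<and> F \<in> borel_measurable borel \<and> t \<in> borel_measurable borel \<and>
     set_integrable lborel (ball 0 1) (\<lambda>x. (w x)\<^sup>2) \<and>
     set_integrable lborel (ball 0 1) (\<lambda>x. (norm (F x))\<^sup>2) \<and>
     set_integrable sphere_measure (sphere 0 1) (\<lambda>x. (t x)\<^sup>2) \<and>
     (\<exists>\<phi>. (\<forall>k::nat. smooth_on_cball (\<phi> k)) \<and>
       (\<lambda>k. LINT x:ball 0 1|lborel. (\<phi> k x - w x)\<^sup>2) \<longlonglongrightarrow> 0 \<and>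
       (\<lambda>k. LINT x:ball 0 1|lborel. (norm (grad (\<phi> k) x - F x))\<^sup>2) \<longlonglongrightarrow> 0 \<and>
       (\<lambda>k. LINT x:sphere 0 1|sphere_measure. (\<phi> k x - t x)\<^sup>2) \<longlonglongrightarrow> 0)"

definition c_const :: "nat \<Rightarrow> real" where
  "c_const n = (real n - 2) / (4 * (real n - 1))"

definition b_const :: "nat \<Rightarrow> real" where
  "b_const n = (real n - 2) / 2"

definition energy ::
  "('n::finite) metric \<Rightarrow> (real^'n \<Rightarrow> real) \<Rightarrow> (real^'n \<Rightarrow> real^'n) \<Rightarrow> (real^'n \<Rightarrow> real) \<Rightarrow> real" where
  "energy G w F t =
     (LINT x:ball 0 1|lborel.
        (conorm2 G x (F x) + c_const CARD('n) * scalar_curvature G x * (w x)\<^sup>2) * vol_density G x)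
     + b_const CARD('n) *
       (LINT x:sphere 0 1|sphere_measure. mean_curvature G x * (t x)\<^sup>2 * area_density G x)"

definition boundary_norm2 :: "('n::finite) metric \<Rightarrow> (real^'n \<Rightarrow> real) \<Rightarrow> real" where
  "boundary_norm2 G t = (LINT x:sphere 0 1|sphere_measure. (t x)\<^sup>2 * area_density G x)"

text \<open>The variational expression of the first eigenvalue, valid for metrics for which
  the first Dirichlet eigenvalue of the conformal Laplacian is positive, in particular for all
  metrics conformal to the Euclidean one. The infimum is taken in \<open>ereal\<close> in order not to depend
  on the value of \<open>Inf\<close> at sets of reals that are not bounded below.\<close>

definition sigma1 :: "('n::finite) metric \<Rightarrow> ereal" where
  "sigma1 G = Inf {ereal (energy G w F t / boundary_norm2 G t) | w F t.
     H1_with_trace w F t \<and> boundary_norm2 G t \<noteq> 0}"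


section \<open>The conformal class of the Euclidean metric\<close>

definition flat_metric :: "('n::finite) metric" where
  "flat_metric x = mat 1"

definition conformal_factors :: "(real^'n::finite \<Rightarrow> real) set" where
  "conformal_factors = {u. smooth_on_cball u \<and> (\<forall>x\<in>cball 0 1. u x > 0)}"

definition conformal_metric :: "(real^'n::finite \<Rightarrow> real) \<Rightarrow> 'n metric" where
  "conformal_metric u x = (u x powr (4 / (real CARD('n) - 2))) *\<^sub>R flat_metric x"

text \<open>The metrics of the conformal class are parametrised by their conformal factors; the factor
  \<open>\<lambda>_. 1\<close> gives the Euclidean metric.\<close>

definition normalized_sigma1 :: "(real^'n::finite \<Rightarrow> real) \<Rightarrow> ereal" where
  "normalized_sigma1 u = sigma1 (conformal_metric u) *
     ereal (LINT x:sphere 0 1|sphere_measure. u x powr (2 / (real CARD('n) - 2)))"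

definition sigma1_star :: "'n::finite itself \<Rightarrow> ereal" where
  "sigma1_star _ = (SUP u\<in>(conformal_factors :: (real^'n \<Rightarrow> real) set). normalized_sigma1 u)"

end

theory Submission
  imports Defs
begin

text \<open>
  For \<open>g = u\<^bsup>4/(n-2)\<^esup> g\<^sub>0\<close> the energy is conformally covariant: the energy of \<open>v / u\<close> for \<open>g\<close> is
  \<open>\<integral>|grad v|\<^sup>2 + b\<^sub>n \<integral>v\<^sup>2\<close>, and its boundary norm is \<open>\<integral>v\<^sup>2 \<rho>\<close> with \<open>\<rho> = u\<^bsup>2/(n-2)\<^esup>\<close>. The test function
  \<open>v = 1\<close> bounds the normalised eigenvalue by \<open>b\<^sub>n\<close> times the area of the sphere, and for \<open>u = 1\<close> the bound is
  attained since \<open>\<integral>|grad v|\<^sup>2 \<ge> 0\<close>. If it is attained for \<open>u\<close>, then \<open>v = 1\<close> is a minimiser; testing with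
  \<open>v = 1 + s \<rho>\<close> and letting \<open>s\<close> tend to \<open>0\<close> gives the equality case of Cauchy-Schwarz for \<open>1\<close> and \<open>\<rho>\<close>, so
  \<open>u\<close> is constant on the sphere. When the scalar curvature vanishes, \<open>u\<close> is harmonic, hence constant.

  The divergence theorem on the ball comes from the translation invariance of Lebesgue measure: the
  integral of a partial derivative of a compactly supported Lipschitz function is zero, and this is applied to
  \<open>min 1 (N (1 - |x|)) f x\<close> as \<open>N\<close> tends to infinity.
\<close>

section \<open>Calculus of partial derivatives\<close>

lemma pd_eq: "(f has_derivative D) (at x) \<Longrightarrow> pd i f x = D (axis i 1)"
  unfolding pd_def using frechet_derivative_at by metis

text \<open>A linear functional is determined by its values on the coordinate axes. The rules for
  sums, products, powers and inverses below are read off from this form of the derivative.\<close>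

lemma has_derivative_grad:
  assumes "f differentiable (at x)"
  shows "(f has_derivative (\<lambda>h. grad f x \<bullet> h)) (at x)"
proof -
  obtain D where D: "(f has_derivative D) (at x)"
    using assms by (auto simp: differentiable_def)
  interpret D: bounded_linear D using D by (rule has_derivative_bounded_linear)
  have "D h = grad f x \<bullet> h" for h
  proof -
    have "D h = D (\<Sum>i\<in>UNIV. (h $ i) *\<^sub>R axis i 1)"
      by (metis basis_expansion scalar_mult_eq_scaleR)
    also have "\<dots> = grad f x \<bullet> h"
      by (simp add: D.sum D.scaleR grad_def inner_vec_def pd_eq[OF D] mult.commute)
    finally show ?thesis .
  qed
  then have "D = (\<lambda>h. grad f x \<bullet> h)" by auto
  then show ?thesis using D by simp
qed

lemma norm_grad_sq: "(norm (grad f x))\<^sup>2 = (\<Sum>i\<in>UNIV. (pd i f x)\<^sup>2)"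
  unfolding power2_norm_eq_inner inner_vec_def grad_def by (simp add: power2_eq_square)

lemma pd_has_real_derivative:
  assumes "f differentiable (at x)"
  shows "((\<lambda>t. f (x + t *\<^sub>R axis i 1)) has_real_derivative pd i f x) (at 0)"
proof -
  have 1: "((\<lambda>t. x + t *\<^sub>R axis i (1::real)) has_derivative (\<lambda>t. t *\<^sub>R axis i 1)) (at 0)"
    by (auto intro!: derivative_eq_intros)
  have 2: "(f has_derivative (\<lambda>h. grad f x \<bullet> h)) (at (x + 0 *\<^sub>R axis i 1))"
    using has_derivative_grad[OF assms] by simp
  show ?thesis
    using has_derivative_compose[OF 1 2]
    by (simp add: has_field_derivative_def grad_def inner_axis mult_commute_abs)
qed

text \<open>Both functions have the same derivatives at \<open>x\<close>, so the choice made by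
  \<open>frechet_derivative\<close> is the same, even where there is no derivative.\<close>

lemma pd_cong:
  assumes "open U" "x \<in> U" "\<And>y. y \<in> U \<Longrightarrow> f y = g y"
  shows "pd i f x = pd i g x"
proof -
  have "(f has_derivative D) (at x) \<longleftrightarrow> (g has_derivative D) (at x)" for D
    using has_derivative_transform_within_open[of f D x UNIV U g]
      has_derivative_transform_within_open[of g D x UNIV U f] assms by auto
  then show ?thesis by (simp add: pd_def frechet_derivative_def)
qed

lemma differentiable_cong_open:
  assumes "open U" "x \<in> U" "\<And>y. y \<in> U \<Longrightarrow> f y = g y" "f differentiable (at x)"
  shows "g differentiable (at x)"
proof -
  obtain D where "(f has_derivative D) (at x)" using assms(4) by (auto simp: differentiable_def)
  then have "(g has_derivative D) (at x)"
    using assms(1-3) by (rule has_derivative_transform_within_open)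
  then show ?thesis by (auto simp: differentiable_def)
qed

lemma pd_const: "pd i (\<lambda>_. c) x = 0"
  by (rule pd_eq[where D="\<lambda>_. 0"]) simp

lemma pd_add:
  assumes "f differentiable (at x)" "g differentiable (at x)"
  shows "pd i (\<lambda>y. f y + g y) x = pd i f x + pd i g x"
  by (subst pd_eq[OF has_derivative_add[OF assms[THEN has_derivative_grad]]])
    (simp add: grad_def inner_axis)

lemma pd_diff:
  assumes "f differentiable (at x)" "g differentiable (at x)"
  shows "pd i (\<lambda>y. f y - g y) x = pd i f x - pd i g x"
  by (subst pd_eq[OF has_derivative_diff[OF assms[THEN has_derivative_grad]]])
    (simp add: grad_def inner_axis)

lemma pd_mult:
  assumes "f differentiable (at x)" "g differentiable (at x)"
  shows "pd i (\<lambda>y. f y * g y) x = f x * pd i g x + pd i f x * g x"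
  by (subst pd_eq[OF has_derivative_mult[OF assms[THEN has_derivative_grad]]])
    (simp add: grad_def inner_axis)

lemma pd_cmult:
  assumes "f differentiable (at x)"
  shows "pd i (\<lambda>y. c * f y) x = c * pd i f x"
  using pd_mult[OF differentiable_const assms] by (simp add: pd_const)

lemma has_derivative_powr_const:
  fixes f :: "real^'n \<Rightarrow> real"
  assumes "(f has_derivative D) (at x)" "f x > 0"
  shows "((\<lambda>y. f y powr a) has_derivative (\<lambda>h. a * f x powr (a - 1) * D h)) (at x)"
proof -
  have "((\<lambda>t. t powr a) has_derivative (\<lambda>h. (a * f x powr (a - 1)) * h)) (at (f x))"
    using has_real_derivative_powr[OF assms(2), of a] by (simp add: has_field_derivative_def)
  from has_derivative_compose[OF assms(1) this] show ?thesis .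
qed

lemma pd_powr:
  fixes f :: "real^'n \<Rightarrow> real"
  assumes "f differentiable (at x)" "f x > 0"
  shows "pd i (\<lambda>y. f y powr a) x = a * f x powr (a - 1) * pd i f x"
  by (subst pd_eq[OF has_derivative_powr_const[OF assms(1)[THEN has_derivative_grad] assms(2)]])
    (simp add: grad_def inner_axis)

lemma differentiable_powr_const:
  fixes f :: "real^'n \<Rightarrow> real"
  assumes "f differentiable (at x)" "f x > 0"
  shows "(\<lambda>y. f y powr a) differentiable (at x)"
  using has_derivative_powr_const[OF assms(1)[THEN has_derivative_grad] assms(2)]
  by (auto simp: differentiable_def)

lemma has_derivative_inverse_real:
  fixes f :: "real^'n::finite \<Rightarrow> real"
  assumes "f differentiable (at x)" "f x \<noteq> 0"
  shows "((\<lambda>y. inverse (f y)) has_derivative (\<lambda>h. - (inverse (f x) * (grad f x \<bullet> h) * inverse (f x)))) (at x)"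
  using Deriv.has_derivative_inverse[OF assms(2) has_derivative_grad[OF assms(1)]] .

lemma pd_inverse:
  fixes f :: "real^'n::finite \<Rightarrow> real"
  assumes "f differentiable (at x)" "f x \<noteq> 0"
  shows "pd i (\<lambda>y. inverse (f y)) x = - pd i f x / (f x)\<^sup>2"
  by (subst pd_eq[OF has_derivative_inverse_real[OF assms]])
    (simp add: grad_def inner_axis power2_eq_square divide_inverse)

lemma pd_component: "pd i (\<lambda>y. y $ k) x = (if i = k then 1 else 0)"
proof -
  have "((\<lambda>y. y $ k) has_derivative (\<lambda>h. h $ k)) (at x)"
    by (rule bounded_linear_imp_has_derivative) (rule bounded_linear_vec_nth)
  from pd_eq[OF this] show ?thesis by (simp add: axis_def)
qed

lemma pd_norm: "x \<noteq> 0 \<Longrightarrow> pd i norm x = x $ i / norm x"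
  by (subst pd_eq[OF has_derivative_norm])
    (simp_all add: inner_axis inner_axis' sgn_div_norm divide_inverse_commute)

section \<open>Closure properties of the classes \<open>Ck_on\<close>\<close>

lemma Ck_on_cong:
  assumes "open U" "\<And>y. y \<in> U \<Longrightarrow> f y = g y" "Ck_on k U f"
  shows "Ck_on k U g"
  using assms(2-)
proof (induction k arbitrary: f g)
  case 0
  then show ?case using continuous_on_cong[of U U f g] by simp
next
  case (Suc k)
  have "g differentiable (at x)" if "x \<in> U" for x
    by (rule differentiable_cong_open[OF assms(1) that Suc.prems(1)])
      (use Suc.prems(2) that assms(1) in \<open>auto simp: differentiable_on_eq_differentiable_at\<close>)
  then have "g differentiable_on U"
    by (simp add: differentiable_on_eq_differentiable_at[OF assms(1)])
  moreover have "Ck_on k U (pd i g)" for i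
  proof (rule Suc.IH)
    show "pd i f y = pd i g y" if "y \<in> U" for y
      using assms(1) that Suc.prems(1) by (rule pd_cong)
  qed (use Suc.prems(2) in simp)
  ultimately show ?case by simp
qed

lemma Ck_on_mono:
  assumes "V \<subseteq> U" "Ck_on k U f"
  shows "Ck_on k V f"
  using assms(2)
proof (induction k arbitrary: f)
  case 0
  then show ?case using assms(1) continuous_on_subset by auto
next
  case (Suc k)
  then show ?case using assms(1) by (auto intro: differentiable_on_subset)
qed

lemma Ck_on_Suc_imp:
  assumes "Ck_on (Suc k) U f"
  shows "Ck_on k U f"
  using assms
proof (induction k arbitrary: f)
  case 0
  then show ?case by (auto intro: differentiable_imp_continuous_on)
next
  case (Suc k)
  then show ?case by (metis Ck_on.simps(2))
qed

lemma Ck_on_const: "Ck_on k U (\<lambda>_. c)"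
proof (induction k arbitrary: c)
  case (Suc k)
  moreover have "pd i (\<lambda>_. c) = (\<lambda>_. 0)" for i :: 'a by (auto simp: pd_const)
  ultimately show ?case by simp
qed simp

lemma Ck_on_add:
  assumes "open U" "Ck_on k U f" "Ck_on k U g"
  shows "Ck_on k U (\<lambda>x. f x + g x)"
  using assms(2-)
proof (induction k arbitrary: f g)
  case 0
  then show ?case by (auto intro: continuous_intros)
next
  case (Suc k)
  have "Ck_on k U (pd i (\<lambda>x. f x + g x))" for i
    by (rule Ck_on_cong[OF assms(1) _ Suc.IH[of "pd i f" "pd i g"]])
      (use Suc.prems assms(1) in \<open>auto simp: pd_add differentiable_on_eq_differentiable_at\<close>)
  then show ?case using Suc.prems by auto
qed

text \<open>The product rule is known only on \<open>U\<close>, where both factors are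
  differentiable; hence the passage through \<open>Ck_on_cong\<close>. It puts \<open>f\<close> next
  to \<open>pd i f\<close>, so the order of \<open>f\<close> has to be lowered by
  \<open>Ck_on_Suc_imp\<close>.\<close>

lemma Ck_on_mult:
  assumes "open U" "Ck_on k U f" "Ck_on k U g"
  shows "Ck_on k U (\<lambda>x. f x * g x)"
  using assms(2-)
proof (induction k arbitrary: f g)
  case 0
  then show ?case by (auto intro: continuous_intros)
next
  case (Suc k)
  have "Ck_on k U (pd i (\<lambda>x. f x * g x))" for i
  proof (rule Ck_on_cong[OF assms(1)])
    show "Ck_on k U (\<lambda>x. f x * pd i g x + pd i f x * g x)"
      by (intro Ck_on_add[OF assms(1)] Suc.IH) (use Suc.prems Ck_on_Suc_imp in auto)
  qed (use Suc.prems assms(1) in \<open>auto simp: pd_mult differentiable_on_eq_differentiable_at\<close>)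
  then show ?case using Suc.prems by auto
qed

text \<open>Differentiation lowers the exponent by one, so the induction treats all exponents at
  once.\<close>

lemma Ck_on_powr:
  assumes "open U" "Ck_on k U f" "\<And>x. x \<in> U \<Longrightarrow> f x > 0"
  shows "Ck_on k U (\<lambda>x. f x powr a)"
  using assms(2)
proof (induction k arbitrary: a)
  case 0
  then show ?case using assms(3) by (auto intro!: continuous_intros less_imp_neq[symmetric])
next
  case (Suc k)
  have d: "f differentiable (at x)" if "x \<in> U" for x
    using Suc.prems assms(1) that by (auto simp: differentiable_on_eq_differentiable_at)
  have "Ck_on k U (pd i (\<lambda>x. f x powr a))" for i
  proof (rule Ck_on_cong[OF assms(1)])
    show "Ck_on k U (\<lambda>x. a * f x powr (a - 1) * pd i f x)"
      by (intro Ck_on_mult[OF assms(1)] Ck_on_const Suc.IH Ck_on_Suc_imp[OF Suc.prems])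
        (use Suc.prems in auto)
  qed (use d assms(3) in \<open>auto simp: pd_powr\<close>)
  then show ?case
    using d assms(3) differentiable_powr_const[OF d] assms(1)
    by (auto simp: differentiable_on_eq_differentiable_at)
qed

section \<open>Functions smooth up to the boundary\<close>

lemma smooth_on_cball_const: "smooth_on_cball (\<lambda>_. c)"
  unfolding smooth_on_cball_def using Ck_on_const by blast

lemma smooth_on_cball_add:
  assumes "smooth_on_cball f" "smooth_on_cball g"
  shows "smooth_on_cball (\<lambda>x. f x + g x)"
proof -
  obtain U V where "open U" "cball 0 1 \<subseteq> U" "\<forall>k. Ck_on k U f"
    "open V" "cball 0 1 \<subseteq> V" "\<forall>k. Ck_on k V g"
    using assms unfolding smooth_on_cball_def by blast
  then show ?thesis unfolding smooth_on_cball_def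
    by (intro exI[of _ "U \<inter> V"]) (auto intro!: Ck_on_add intro: Ck_on_mono[rotated])
qed

lemma smooth_on_cball_mult:
  assumes "smooth_on_cball f" "smooth_on_cball g"
  shows "smooth_on_cball (\<lambda>x. f x * g x)"
proof -
  obtain U V where "open U" "cball 0 1 \<subseteq> U" "\<forall>k. Ck_on k U f"
    "open V" "cball 0 1 \<subseteq> V" "\<forall>k. Ck_on k V g"
    using assms unfolding smooth_on_cball_def by blast
  then show ?thesis unfolding smooth_on_cball_def
    by (intro exI[of _ "U \<inter> V"]) (auto intro!: Ck_on_mult intro: Ck_on_mono[rotated])
qed

lemma smooth_on_cball_pd:
  assumes "smooth_on_cball f"
  shows "smooth_on_cball (pd i f)"
proof -
  obtain U where U: "open U" "cball 0 1 \<subseteq> U" "\<And>k. Ck_on k U f"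
    using assms unfolding smooth_on_cball_def by blast
  have "Ck_on k U (pd i f)" for k using U(3)[of "Suc k"] by simp
  then show ?thesis using U(1,2) unfolding smooth_on_cball_def by blast
qed

text \<open>Positivity spreads from the closed ball to a neighbourhood by continuity. Formulas
  involving \<open>u powr a\<close> then hold on an open set and can be differentiated at boundary
  points.\<close>

lemma conformal_factor_nhd:
  assumes "u \<in> conformal_factors"
  obtains U where "open U" "cball 0 1 \<subseteq> U" "\<And>k. Ck_on k U u" "\<And>x. x \<in> U \<Longrightarrow> u x > 0"
proof -
  obtain U where U: "open U" "cball 0 1 \<subseteq> U" "\<forall>k. Ck_on k U u"
    using assms unfolding smooth_on_cball_def conformal_factors_def by blast
  have "continuous_on U u" using U(3)[rule_format, of 0] by simp
  then have "open (U \<inter> u -` {0<..})" using U(1) by (intro continuous_open_preimage) auto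
  then show ?thesis
    using U assms by (intro that[of "U \<inter> u -` {0<..}"])
      (auto simp: conformal_factors_def intro: Ck_on_mono[rotated])
qed

lemma smooth_on_cball_powr:
  assumes "u \<in> conformal_factors"
  shows "smooth_on_cball (\<lambda>x. u x powr a)"
proof -
  obtain U where "open U" "cball 0 1 \<subseteq> U" "\<And>k. Ck_on k U u" "\<And>x. x \<in> U \<Longrightarrow> u x > 0"
    using conformal_factor_nhd[OF assms] by metis
  then show ?thesis
    unfolding smooth_on_cball_def by (intro exI[of _ U] conjI allI Ck_on_powr) auto
qed

lemma smooth_on_cball_differentiable:
  assumes "smooth_on_cball f" "x \<in> cball 0 1"
  shows "f differentiable (at x)"
proof -
  obtain U where "open U" "cball 0 1 \<subseteq> U" "Ck_on 1 U f"
    using assms unfolding smooth_on_cball_def by blast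
  then show ?thesis using assms(2) by (auto simp: differentiable_on_eq_differentiable_at)
qed

lemma smooth_on_cball_continuous:
  assumes "smooth_on_cball f"
  shows "continuous_on (cball 0 1) f"
  by (intro continuous_at_imp_continuous_on ballI differentiable_imp_continuous_within
      smooth_on_cball_differentiable[OF assms])

lemma smooth_on_cball_grad_continuous:
  assumes "smooth_on_cball f"
  shows "continuous_on (cball 0 1) (grad f)"
  unfolding grad_def
  by (rule continuous_on_vec_lambda) (rule smooth_on_cball_continuous[OF smooth_on_cball_pd[OF assms]])

section \<open>Integration over the ball and the sphere\<close>

lemma scale_measure_eq_density: "scale_measure r M = density M (\<lambda>_. r)"
  by (rule measure_eqI) (simp_all add: emeasure_density nn_integral_cmult_indicator)

lemma sets_sphere_measure [simp, measurable_cong]: "sets sphere_measure = sets borel"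
  and space_sphere_measure [simp]: "space sphere_measure = UNIV"
  by (simp_all add: sphere_measure_def)

lemma borel_measurable_sgn_vec [measurable]:
  "(sgn :: real^'n \<Rightarrow> real^'n) \<in> borel_measurable borel"
  unfolding sgn_div_norm by measurable

lemma borel_measurable_sgn_scale_measure:
  "(sgn :: real^'n::finite \<Rightarrow> real^'n)
    \<in> borel_measurable (scale_measure r (restrict_space lborel (ball 0 1)))"
proof -
  have "sets (scale_measure r (restrict_space lborel (ball (0::real^'n) 1)))
      = sets (restrict_space borel (ball 0 1))"
    by (simp add: sets_restrict_space)
  from measurable_cong_sets[OF this refl] show ?thesis
    using measurable_restrict_space1[OF borel_measurable_sgn_vec, of "ball 0 1"] by blast
qed

lemma finite_measure_sphere_measure: "finite_measure (sphere_measure :: (real^'n::finite) measure)"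
proof
  have "emeasure (sphere_measure :: (real^'n::finite) measure) UNIV
      = of_nat CARD('n) * emeasure lborel (ball (0::real^'n) 1)"
    unfolding sphere_measure_def
    by (subst emeasure_distr)
       (auto simp: space_scale_measure space_restrict_space emeasure_restrict_space
          intro!: borel_measurable_sgn_scale_measure)
  also have "\<dots> < \<infinity>"
    using emeasure_lborel_ball_finite[of "0::real^'n" 1]
    by (simp add: ennreal_mult_less_top of_nat_less_top)
  finally show "emeasure (sphere_measure :: (real^'n) measure) (space sphere_measure) \<noteq> \<infinity>"
    by simp
qed

text \<open>Unfolds the cone description of surface measure: change of variables for the
  push-forward under \<open>sgn\<close>, with the factor \<open>CARD('n)\<close> pulled out as a
  constant density.\<close>

lemma sphere_integral_eq:
  fixes f :: "real^'n::finite \<Rightarrow> real"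
  assumes [measurable]: "(\<lambda>x. indicator (sphere 0 1) x *\<^sub>R f x) \<in> borel_measurable borel"
  shows "(LINT x:sphere 0 1|sphere_measure. f x)
    = real CARD('n) * (LINT x:ball 0 1|lborel. f (sgn x))"
proof -
  let ?g = "\<lambda>x. indicator (sphere 0 1) x *\<^sub>R f x"
  have "(LINT x:sphere 0 1|sphere_measure. f x)
      = integral\<^sup>L (scale_measure (of_nat CARD('n)) (restrict_space lborel (ball 0 1))) (\<lambda>x. ?g (sgn x))"
    unfolding set_lebesgue_integral_def sphere_measure_def
    by (rule integral_distr) (use assms borel_measurable_sgn_scale_measure in simp_all)
  also have "scale_measure (of_nat CARD('n)) (restrict_space lborel (ball 0 1))
      = density (restrict_space lborel (ball (0::real^'n) 1)) (\<lambda>_. ennreal (real CARD('n)))"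
    by (simp add: scale_measure_eq_density ennreal_of_nat_eq_real_of_nat)
  also have "integral\<^sup>L \<dots> (\<lambda>x. ?g (sgn x))
      = real CARD('n) * (LINT x|restrict_space lborel (ball 0 1). ?g (sgn x))"
  proof (subst integral_density)
    have "(\<lambda>x. ?g (sgn x)) \<in> borel_measurable borel" by measurable
    then show "(\<lambda>x. ?g (sgn x)) \<in> borel_measurable (restrict_space lborel (ball 0 1))"
      by (intro measurable_restrict_space1) simp
  qed auto
  also have "(LINT x|restrict_space lborel (ball 0 1). ?g (sgn x))
      = (LINT x:ball 0 1|lborel. ?g (sgn x))"
    by (subst integral_restrict_space) (auto simp: set_lebesgue_integral_def)
  \<comment> \<open>The integrands differ at most at the origin, where \<open>sgn\<close> takes the
    value 0 and so leaves the sphere.\<close>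
  also have "\<dots> = (LINT x:ball 0 1|lborel. f (sgn x))"
    unfolding set_lebesgue_integral_def
  proof (rule integral_cong_AE)
    have "AE x in lborel. x \<noteq> (0::real^'n)" by (rule AE_lborel_singleton)
    then show "AE x in lborel. indicator (ball 0 1) x *\<^sub>R ?g (sgn x)
        = indicator (ball 0 1) x *\<^sub>R f (sgn x)"
      by eventually_elim (auto simp: indicator_def norm_sgn)
    \<comment> \<open>The second function restores the value \<open>f 0\<close> at the origin, which
      makes \<open>f (sgn x)\<close> on the ball Borel measurable although \<open>f\<close> is
      controlled only on the sphere.\<close>
    have *: "(\<lambda>x. indicator (ball 0 1) x *\<^sub>R h x) \<in> borel_measurable lborel"
      "(\<lambda>x. indicator (ball 0 1) x *\<^sub>R h x + indicator {0} x *\<^sub>R f 0) \<in> borel_measurable borel"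
      if "h \<in> borel_measurable borel" for h :: "real^'n \<Rightarrow> real"
      using that by (intro borel_measurable_add borel_measurable_scaleR borel_measurable_indicator; simp)+
    have g: "(\<lambda>x. ?g (sgn x)) \<in> borel_measurable borel" by measurable
    then show "(\<lambda>x. indicator (ball 0 1) x *\<^sub>R ?g (sgn x)) \<in> borel_measurable lborel"
      by (rule *)
    from g have "(\<lambda>x. indicator (ball 0 1) x *\<^sub>R ?g (sgn x) + indicator {0} x *\<^sub>R f 0)
        \<in> borel_measurable borel" by (rule *)
    also have "(\<lambda>x. indicator (ball 0 1) x *\<^sub>R ?g (sgn x) + indicator {0} x *\<^sub>R f 0)
        = (\<lambda>x. indicator (ball 0 1) x *\<^sub>R f (sgn x))"
      by (auto simp: indicator_def norm_sgn)
    finally show "(\<lambda>x. indicator (ball 0 1) x *\<^sub>R f (sgn x)) \<in> borel_measurable lborel"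
      by simp
  qed
  finally show ?thesis .
qed

section \<open>Integrals of continuous functions: integrability and positivity\<close>

lemma indicator_continuous_measurable:
  fixes f :: "real^'n::finite \<Rightarrow> real"
  assumes "continuous_on (sphere 0 1) f"
  shows "(\<lambda>x. indicator (sphere 0 1) x *\<^sub>R f x) \<in> borel_measurable borel"
  using assms by (intro borel_measurable_continuous_on_indicator) auto

lemma sphere_integrable:
  fixes f :: "real^'n::finite \<Rightarrow> real"
  assumes "continuous_on (sphere 0 1) f"
  shows "set_integrable sphere_measure (sphere 0 1) f"
proof -
  interpret finite_measure "sphere_measure :: (real^'n) measure"
    by (rule finite_measure_sphere_measure)
  have "compact (f ` sphere 0 1)" using assms by (intro compact_continuous_image) auto
  then obtain B where B: "\<And>x. x \<in> sphere 0 1 \<Longrightarrow> norm (f x) \<le> B"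
    by (meson compact_imp_bounded bounded_iff imageI)
  have "norm (indicator (sphere 0 1) x *\<^sub>R f x) \<le> max B 0" for x
    using B[of x] by (cases "x \<in> sphere 0 1") (auto simp: indicator_def)
  then show ?thesis
    unfolding set_integrable_def
    by (intro integrable_const_bound[where B="max B 0"])
       (use indicator_continuous_measurable[OF assms] in auto)
qed

lemma ball_integrable:
  fixes f :: "real^'n::finite \<Rightarrow> 'b::{banach, second_countable_topology}"
  assumes "continuous_on (cball 0 1) f" "A \<in> sets borel" "A \<subseteq> cball 0 1"
  shows "set_integrable lborel A f"
proof (rule set_integrable_subset)
  show "set_integrable lborel (cball 0 1) f"
    unfolding set_integrable_def using assms(1) by (intro borel_integrable_compact) auto
qed (use assms in auto)

text \<open>The set where \<open>f\<close> is nonzero is open and null, hence empty.\<close>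

lemma set_integral_zero_imp_zero:
  fixes f :: "real^'n::finite \<Rightarrow> real"
  assumes "open S" "continuous_on S f" "\<And>x. x \<in> S \<Longrightarrow> f x \<ge> 0"
    and "set_integrable lborel S f" "(LINT x:S|lborel. f x) = 0" and "x \<in> S"
  shows "f x = 0"
proof -
  have "AE x in lborel. indicator S x *\<^sub>R f x = 0"
    using assms unfolding set_integrable_def set_lebesgue_integral_def
    by (subst integral_nonneg_eq_0_iff_AE[symmetric]) (auto simp: indicator_def)
  moreover have op: "open (S \<inter> f -` (- {0}))"
    using assms by (intro continuous_open_preimage) auto
  ultimately have "S \<inter> f -` (- {0}) \<in> null_sets lborel"
    by (subst AE_iff_null_sets) (auto elim!: eventually_mono simp: indicator_def)
  then have "S \<inter> f -` (- {0}) = {}"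
    using op open_not_negligible negligible_iff_null_sets null_sets_completionI by blast
  then show ?thesis using assms by auto
qed

lemma continuous_on_comp_sgn:
  fixes f :: "real^'n::finite \<Rightarrow> real"
  assumes "continuous_on (sphere 0 1) f"
  shows "continuous_on (ball 0 1 - {0}) (\<lambda>x. f (sgn x))"
proof (rule continuous_on_compose2[OF assms])
  show "continuous_on (ball 0 1 - {0}) (sgn :: real^'n \<Rightarrow> real^'n)"
    unfolding sgn_div_norm by (intro continuous_intros) auto
qed (auto simp: norm_sgn split: if_splits)

lemma comp_sgn_integrable:
  fixes f :: "real^'n::finite \<Rightarrow> real"
  assumes "continuous_on (sphere 0 1) f"
  shows "set_integrable lborel (ball 0 1) (\<lambda>x. f (sgn x))"
proof -
  have "compact (f ` sphere 0 1)" using assms by (intro compact_continuous_image) auto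
  then obtain B where B: "\<And>x. x \<in> sphere 0 1 \<Longrightarrow> norm (f x) \<le> B"
    by (meson compact_imp_bounded bounded_iff imageI)
  have 1: "(\<lambda>x. indicator (ball 0 1 - {0}) x *\<^sub>R f (sgn x)) \<in> borel_measurable borel"
    by (rule borel_measurable_continuous_on_indicator[OF _ continuous_on_comp_sgn[OF assms]]) auto
  have 2: "(\<lambda>x::real^'n. indicator {0} x *\<^sub>R f 0) \<in> borel_measurable borel" by simp
  have "(\<lambda>x. indicator (ball 0 1 - {0}) x *\<^sub>R f (sgn x) + indicator {0} x *\<^sub>R f 0) \<in> borel_measurable borel"
    using 1 2 by (rule borel_measurable_add)
  also have "(\<lambda>x. indicator (ball 0 1 - {0}) x *\<^sub>R f (sgn x) + indicator {0} x *\<^sub>R f 0)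
    = (\<lambda>x. indicator (ball 0 1) x *\<^sub>R f (sgn x))"
    by (auto simp: indicator_def)
  finally have m: "(\<lambda>x. indicator (ball 0 1) x *\<^sub>R f (sgn x)) \<in> borel_measurable borel" .
  \<comment> \<open>The bound \<open>B\<close> on the sphere does not cover the origin, where
    \<open>f (sgn 0)\<close> is \<open>f 0\<close>; the dominating constant takes this value into
    account.\<close>
  show ?thesis unfolding set_integrable_def
  proof (rule Bochner_Integration.integrable_bound[where f="\<lambda>x::real^'n. indicator (ball 0 1) x *\<^sub>R max B \<bar>f 0\<bar>"])
    show "integrable lborel (\<lambda>x::real^'n. indicator (ball 0 1) x *\<^sub>R max B \<bar>f 0\<bar>)"
      using emeasure_lborel_ball_finite[of "0::real^'n" 1] by (intro integrable_scaleR_left) auto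
    show "AE x in lborel. norm (indicator (ball 0 1) x *\<^sub>R f (sgn x))
        \<le> norm (indicator (ball 0 1) x *\<^sub>R max B \<bar>f 0\<bar>)"
    proof (rule AE_I2)
      fix x :: "real^'n"
      show "norm (indicator (ball 0 1) x *\<^sub>R f (sgn x))
        \<le> norm (indicator (ball 0 1) x *\<^sub>R max B \<bar>f 0\<bar>)"
        using B[of "sgn x"] by (cases "x = 0") (auto simp: indicator_def norm_sgn)
    qed
  qed (use m in simp)
qed

text \<open>The corresponding fact for Lebesgue measure is applied to the radially constant
  extension of \<open>f\<close> on the punctured ball, which is open.\<close>

lemma sphere_integral_zero_imp_zero:
  fixes f :: "real^'n::finite \<Rightarrow> real"
  assumes c: "continuous_on (sphere 0 1) f" and nn: "\<And>x. x \<in> sphere 0 1 \<Longrightarrow> f x \<ge> 0"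
    and 0: "(LINT x:sphere 0 1|sphere_measure. f x) = 0" and x: "x \<in> sphere 0 1"
  shows "f x = 0"
proof -
  let ?g = "\<lambda>x. f (sgn x)"
  have i: "set_integrable lborel (ball 0 1) ?g" by (rule comp_sgn_integrable[OF c])
  have "(LINT x:ball 0 1|lborel. ?g x) = 0"
    using 0 sphere_integral_eq[OF indicator_continuous_measurable[OF c]] by simp
  also have "(LINT x:ball 0 1|lborel. ?g x) = (LINT x:ball 0 1 - {0}|lborel. ?g x)"
    by (rule set_integral_cong_set)
      (use i set_integrable_subset[OF i, of "ball 0 1 - {0}"] AE_lborel_singleton[of "0::real^'n"]
        in \<open>auto simp: set_borel_measurable_def set_integrable_def elim!: eventually_mono\<close>)
  finally have z: "(LINT x:ball 0 1 - {0}|lborel. ?g x) = 0" .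
  \<comment> \<open>Any interior point of the ray through \<open>x\<close> would serve; the midpoint
    of the radius is taken.\<close>
  have "?g ((1/2) *\<^sub>R x) = 0"
  proof (rule set_integral_zero_imp_zero[OF _ continuous_on_comp_sgn[OF c] _ _ z])
    show "set_integrable lborel (ball 0 1 - {0}) ?g"
      by (rule set_integrable_subset[OF i]) auto
  qed (use x nn in \<open>auto simp: norm_sgn\<close>)
  moreover have "sgn ((1/2) *\<^sub>R x) = x" using x by (simp add: sgn_div_norm)
  ultimately show ?thesis by simp
qed

lemma sphere_integral_pos:
  fixes f :: "real^'n::finite \<Rightarrow> real"
  assumes c: "continuous_on (sphere 0 1) f" and pos: "\<And>x. x \<in> sphere 0 1 \<Longrightarrow> f x > 0"
  shows "(LINT x:sphere 0 1|sphere_measure. f x) > 0"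
proof -
  have "(LINT x:sphere 0 1|sphere_measure. f x) \<ge> 0"
    unfolding set_lebesgue_integral_def
    by (rule integral_nonneg_AE) (auto simp: indicator_def intro!: less_imp_le pos)
  moreover have "(LINT x:sphere 0 1|sphere_measure. f x) \<noteq> 0"
  proof
    \<comment> \<open>The index provides a point of the sphere, \<open>axis i 1\<close>.\<close>
    fix i :: 'n
    assume "(LINT x:sphere 0 1|sphere_measure. f x) = 0"
    then have "f (axis i 1) = 0"
      using pos by (intro sphere_integral_zero_imp_zero[OF c]) (auto intro: less_imp_le)
    then show False using pos[of "axis i 1"] by simp
  qed
  ultimately show ?thesis by simp
qed

section \<open>Dilations and translations of Lebesgue measure\<close>

lemma lborel_integral_scaleR:
  fixes f :: "real^'n::finite \<Rightarrow> real"
  assumes "r > 0" and [measurable]: "f \<in> borel_measurable borel"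
  shows "(LINT x|lborel. f x) = r ^ CARD('n) * (LINT x|lborel. f (r *\<^sub>R x))"
proof -
  have "(LINT x|lborel. f x) = (LINT x|density (distr lborel borel (\<lambda>x. 0 + r *\<^sub>R x)) (\<lambda>_. \<bar>r\<bar>^DIM(real^'n)). f x)"
    using lborel_affine[of r "0::real^'n"] assms(1) by simp
  also have "\<dots> = r ^ CARD('n) * (LINT x|lborel. f (r *\<^sub>R x))"
    using assms(1) by (subst integral_density) (auto simp: integral_distr)
  finally show ?thesis .
qed

text \<open>The integrand is invariant under dilations, so only the volume factor changes. This will
  give the integrals over thin shells at the boundary.\<close>

lemma integral_ball_comp_sgn:
  fixes f :: "real^'n::finite \<Rightarrow> real"
  assumes c: "continuous_on (sphere 0 1) f" and r: "0 < r" "r \<le> 1"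
  shows "(LINT x:ball 0 r|lborel. f (sgn x)) = r ^ CARD('n) * (LINT x:ball 0 1|lborel. f (sgn x))"
proof -
  have i: "set_integrable lborel (ball 0 r) (\<lambda>x. f (sgn x))"
    by (rule set_integrable_subset[OF comp_sgn_integrable[OF c]]) (use r in auto)
  have "(LINT x:ball 0 r|lborel. f (sgn x))
      = r ^ CARD('n) * (LINT x|lborel. indicator (ball 0 r) (r *\<^sub>R x) *\<^sub>R f (sgn (r *\<^sub>R x)))"
    unfolding set_lebesgue_integral_def
    by (rule lborel_integral_scaleR[OF r(1)])
      (use i in \<open>auto simp: set_integrable_def dest: borel_measurable_integrable\<close>)
  also have "(\<lambda>x::real^'n. indicator (ball 0 r) (r *\<^sub>R x) *\<^sub>R f (sgn (r *\<^sub>R x)))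
      = (\<lambda>x. indicator (ball 0 1) x *\<^sub>R f (sgn x))"
    using r by (auto simp: indicator_def sgn_scaleR)
  finally show ?thesis by (simp add: set_lebesgue_integral_def)
qed

text \<open>Differentiate the translation invariance of the integral.\<close>

lemma integral_directional_derivative_zero:
  fixes Y :: "real^'n::finite \<Rightarrow> real"
  assumes lip: "\<And>x y. \<bar>Y x - Y y\<bar> \<le> L * norm (x - y)"
    and supp: "\<And>x. norm x \<ge> 1 \<Longrightarrow> Y x = 0"
    and e: "norm e = 1"
    and g[measurable]: "g \<in> borel_measurable borel"
    and deriv: "AE x in lborel. ((\<lambda>t. Y (x + t *\<^sub>R e)) has_real_derivative g x) (at 0)"
  shows "(LINT x|lborel. g x) = 0"
proof -
  have "L-lipschitz_on UNIV Y"
  proof (rule lipschitz_onI)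
    show "0 \<le> L" using lip[of e 0] e abs_ge_zero order_trans by fastforce
  qed (use lip in \<open>auto simp: dist_norm\<close>)
  then have contY: "continuous_on UNIV Y" by (rule lipschitz_on_continuous_on)
  have Y_m[measurable]: "Y \<in> borel_measurable borel"
    using contY by (rule borel_measurable_continuous_onI)
  have L0: "L \<ge> 0" using lip[of e 0] e abs_ge_zero order_trans by fastforce
  have Yi: "integrable lborel Y"
  proof -
    have "integrable lborel (\<lambda>x. indicator (cball 0 1) x *\<^sub>R Y x)"
      by (rule borel_integrable_compact) (use contY continuous_on_subset in auto)
    also have "(\<lambda>x. indicator (cball 0 1) x *\<^sub>R Y x) = Y"
    proof
      show "indicator (cball 0 1) x *\<^sub>R Y x = Y x" for x
        using supp[of x] by (cases "norm x \<le> 1") (auto simp: indicator_def)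
    qed
    finally show ?thesis .
  qed
  define q where "q m x = (Y (x + (1 / real (Suc m)) *\<^sub>R e) - Y x) * real (Suc m)" for m x
  have "(\<lambda>m. LINT x|lborel. q m x) \<longlonglongrightarrow> (LINT x|lborel. g x)"
  proof (rule integral_dominated_convergence)
    \<comment> \<open>The translations have length at most 1 and \<open>Y\<close> vanishes outside
      the unit ball, so all difference quotients vanish outside the ball of radius 2, and they are
      bounded by the Lipschitz constant.\<close>
    show "integrable lborel (\<lambda>x. indicator (cball (0::real^'n) 2) x *\<^sub>R L)"
      using emeasure_compact_finite[of "cball (0::real^'n) 2"] by (intro integrable_scaleR_left) auto
    show "AE x in lborel. (\<lambda>m. q m x) \<longlonglongrightarrow> g x"
      using deriv
    proof eventually_elim
      case (elim x)
      have "((\<lambda>h. (Y (x + h *\<^sub>R e) - Y x) / h) \<longlongrightarrow> g x) (at 0)"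
        using elim by (simp add: DERIV_def)
      moreover have "filterlim (\<lambda>m. 1 / real (Suc m)) (at 0) sequentially"
        unfolding filterlim_at using LIMSEQ_Suc[OF lim_inverse_n']
        by (auto simp: o_def)
      ultimately have "(\<lambda>m. (Y (x + (1 / real (Suc m)) *\<^sub>R e) - Y x) / (1 / real (Suc m))) \<longlonglongrightarrow> g x"
        by (rule filterlim_compose)
      then show ?case by (simp add: q_def)
    qed
    fix m
    show "AE x in lborel. norm (q m x) \<le> indicator (cball 0 2) x *\<^sub>R L"
    proof (rule AE_I2)
      fix x :: "real^'n"
      let ?h = "(1 / real (Suc m)) *\<^sub>R e"
      show "norm (q m x) \<le> indicator (cball 0 2) x *\<^sub>R L"
      proof (cases "norm x \<le> 2")
        case True
        have "\<bar>Y (x + ?h) - Y x\<bar> \<le> L * (1 / real (Suc m))"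
          using lip[of "x + ?h" x] e by simp
        then have "\<bar>Y (x + ?h) - Y x\<bar> * real (Suc m) \<le> L * (1 / real (Suc m)) * real (Suc m)"
          by (rule mult_right_mono) simp
        then show ?thesis using True by (simp add: q_def abs_mult)
      next
        case False
        have "norm ?h \<le> 1" using e by simp
        then have "norm (x + ?h) \<ge> 1" using False norm_diff_ineq[of x ?h] by linarith
        then show ?thesis using False supp by (simp add: q_def)
      qed
    qed
  qed (simp_all add: q_def[abs_def])
  moreover have "(LINT x|lborel. q m x) = 0" for m
  proof -
    let ?h = "(1 / real (Suc m)) *\<^sub>R e"
    have d: "distr lborel borel ((+) ?h) = (lborel :: (real^'n) measure)" by (rule lborel_distr_plus)
    have "integrable lborel (\<lambda>x. Y (?h + x))"
      using Yi integrable_distr_eq[of "(+) ?h" lborel borel Y] d by simp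
    moreover have "(LINT x|lborel. Y (?h + x)) = (LINT x|lborel. Y x)"
      using integral_distr[of "(+) ?h" lborel borel Y] d by simp
    ultimately show ?thesis using Yi by (simp add: q_def add.commute)
  qed
  ultimately show ?thesis by (simp add: LIMSEQ_const_iff)
qed

section \<open>The divergence theorem on the ball\<close>

text \<open>Mean value inequality on the convex ball, with the gradient bounded by
  compactness.\<close>

lemma smooth_on_cball_lipschitz:
  fixes f :: "real^'n::finite \<Rightarrow> real"
  assumes "smooth_on_cball f"
  obtains K where "\<And>x y. x \<in> cball 0 1 \<Longrightarrow> y \<in> cball 0 1 \<Longrightarrow> \<bar>f x - f y\<bar> \<le> K * norm (x - y)" "K \<ge> 0"
proof -
  have "compact (grad f ` cball 0 1)"
    by (intro compact_continuous_image smooth_on_cball_grad_continuous assms) auto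
  then obtain K where K: "\<And>x. x \<in> cball 0 1 \<Longrightarrow> norm (grad f x) \<le> K"
    by (meson compact_imp_bounded bounded_iff imageI)
  show ?thesis
  proof (rule that[of K])
    show "K \<ge> 0" using order_trans[OF norm_ge_zero K[of 0]] by simp
    fix x y :: "real^'n" assume xy: "x \<in> cball 0 1" "y \<in> cball 0 1"
    have "norm (f x - f y) \<le> K * norm (x - y)"
    proof (rule differentiable_bound[OF _ _ _ xy])
      fix z :: "real^'n" assume z: "z \<in> cball 0 1"
      show "(f has_derivative (\<lambda>h. grad f z \<bullet> h)) (at z within cball 0 1)"
        by (rule has_derivative_at_withinI[OF has_derivative_grad[OF
              smooth_on_cball_differentiable[OF assms z]]])
      show "onorm (\<lambda>h. grad f z \<bullet> h) \<le> K"
      proof (rule onorm_le)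
        fix h :: "real^'n"
        have "\<bar>grad f z \<bullet> h\<bar> \<le> norm (grad f z) * norm h" by (rule Cauchy_Schwarz_ineq2)
        also have "\<dots> \<le> K * norm h" by (intro mult_right_mono K z) simp
        finally show "norm (grad f z \<bullet> h) \<le> K * norm h" by simp
      qed
    qed simp
    then show "\<bar>f x - f y\<bar> \<le> K * norm (x - y)" by simp
  qed
qed

text \<open>\<open>Y\<close> is \<open>f\<close> times a cutoff, extended by zero. The cutoff goes
  to zero linearly at the sphere, which makes the extension Lipschitz, with a constant that grows
  with \<open>N\<close>.\<close>

lemma cutoff_lipschitz:
  fixes f :: "real^'n::finite \<Rightarrow> real"
  assumes K: "\<And>x y. x \<in> cball 0 1 \<Longrightarrow> y \<in> cball 0 1 \<Longrightarrow> \<bar>f x - f y\<bar> \<le> K * norm (x - y)" "K \<ge> 0"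
    and M: "\<And>x. x \<in> cball 0 1 \<Longrightarrow> \<bar>f x\<bar> \<le> M" and N: "N \<ge> 0"
    and Y: "Y = (\<lambda>x. if norm x < 1 then min 1 (N * (1 - norm x)) * f x else 0)"
  shows "\<bar>Y x - Y y\<bar> \<le> (K + N * M) * norm (x - y)"
proof -
  have M0: "M \<ge> 0" using order_trans[OF abs_ge_zero M[of 0]] by simp
  define \<eta> where "\<eta> x = min 1 (N * (1 - norm x))" for x :: "real^'n"
  have \<eta>01: "0 \<le> \<eta> x" "\<eta> x \<le> 1" if "norm x < 1" for x using that N by (auto simp: \<eta>_def)
  have \<eta>lip: "\<bar>\<eta> x - \<eta> y\<bar> \<le> N * norm (x - y)" for x y
  proof -
    have "\<bar>\<eta> x - \<eta> y\<bar> \<le> \<bar>N * (1 - norm x) - N * (1 - norm y)\<bar>"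
      unfolding \<eta>_def by linarith
    also have "\<dots> = N * \<bar>norm x - norm y\<bar>"
      using N by (simp add: abs_mult right_diff_distrib[symmetric] abs_minus_commute)
    also have "\<dots> \<le> N * norm (x - y)"
      using N by (intro mult_left_mono norm_triangle_ineq3)
    finally show ?thesis .
  qed
  \<comment> \<open>A segment from \<open>x\<close> to a point outside the ball has length at least
    \<open>1 - norm x\<close>, and the cutoff at \<open>x\<close> is at most \<open>N\<close> times
    this.\<close>
  have out: "\<bar>Y x\<bar> \<le> (K + N * M) * norm (x - y)" if "norm x < 1" "norm y \<ge> 1" for x y
  proof -
    have "\<bar>Y x\<bar> = \<eta> x * \<bar>f x\<bar>" using that \<eta>01[of x] by (simp add: Y \<eta>_def abs_mult)
    also have "\<dots> \<le> (N * norm (x - y)) * M"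
    proof (rule mult_mono)
      have "\<eta> x \<le> N * (1 - norm x)" by (simp add: \<eta>_def)
      also have "\<dots> \<le> N * norm (x - y)"
        using that norm_triangle_ineq2[of y x] N by (intro mult_left_mono) (auto simp: norm_minus_commute)
      finally show "\<eta> x \<le> N * norm (x - y)" .
    qed (use that M N in auto)
    also have "\<dots> \<le> (K + N * M) * norm (x - y)" using K(2) by (simp add: algebra_simps)
    finally show ?thesis .
  qed
  consider "norm x < 1" "norm y < 1" | "norm x < 1" "norm y \<ge> 1" | "norm x \<ge> 1" "norm y < 1"
    | "norm x \<ge> 1" "norm y \<ge> 1" by linarith
  then show ?thesis
  proof cases
    case 1
    have "Y x - Y y = \<eta> x * (f x - f y) + (\<eta> x - \<eta> y) * f y"
      using 1 by (simp add: Y \<eta>_def algebra_simps)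
    then have "\<bar>Y x - Y y\<bar> \<le> \<eta> x * \<bar>f x - f y\<bar> + \<bar>\<eta> x - \<eta> y\<bar> * \<bar>f y\<bar>"
      using \<eta>01(1)[OF 1(1)] abs_triangle_ineq[of "\<eta> x * (f x - f y)" "(\<eta> x - \<eta> y) * f y"]
      by (simp add: abs_mult)
    also have "\<dots> \<le> 1 * (K * norm (x - y)) + (N * norm (x - y)) * M"
      using 1 \<eta>01[OF 1(1)] N by (intro add_mono mult_mono \<eta>lip K(1) M) auto
    finally show ?thesis by (simp add: algebra_simps)
  next
    case 2
    then show ?thesis using out[of x y] by (simp add: Y)
  next
    case 3
    then show ?thesis using out[of y x] by (simp add: Y norm_minus_commute)
  next
    case 4
    then show ?thesis using K(2) M0 N by (simp add: Y)
  qed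
qed

lemma AE_norm_neq: "AE x in lborel. norm (x::real^'n::finite) \<noteq> r"
proof -
  have "sphere (0::real^'n) r \<in> null_sets lborel"
    using negligible_sphere[of "0::real^'n" r]
    by (simp add: negligible_iff_null_sets null_sets_completion_iff)
  then show ?thesis by (rule AE_I') auto
qed

text \<open>The integral of a partial derivative of the cut-off function is zero. The cutoff is
  constant up to radius \<open>1 - 1 / N\<close> and has gradient \<open>- N * sgn x\<close> in the
  shell beyond it, so the product rule produces the two sides.\<close>

lemma cutoff_divergence:
  fixes f :: "real^'n::finite \<Rightarrow> real"
  assumes f: "smooth_on_cball f" and N: "N > 1"
  shows "(LINT x:ball 0 1|lborel. min 1 (N * (1 - norm x)) * pd i f x)
    = N * (LINT x:ball 0 1 - ball 0 (1 - 1 / N)|lborel. f x * sgn x $ i)"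
proof -
  define r where "r = 1 - 1 / N"
  have r: "0 < r" "r < 1" using N by (auto simp: r_def)
  have Nr: "N * (1 - r) = 1" using N by (simp add: r_def)
  define \<eta> where "\<eta> x = min 1 (N * (1 - norm x))" for x :: "real^'n"
  define Y where "Y = (\<lambda>x. if norm x < 1 then min 1 (N * (1 - norm x)) * f x else 0)"
  define g1 where "g1 x = indicator (ball 0 1) x *\<^sub>R (\<eta> x * pd i f x)" for x
  define g2 where "g2 x = indicator (ball 0 1 - ball 0 r) x *\<^sub>R (f x * sgn x $ i)" for x
  have cf: "continuous_on (cball 0 1) f" and cp: "continuous_on (cball 0 1) (pd i f)"
    using f by (auto intro: smooth_on_cball_continuous smooth_on_cball_pd)
  have g1: "integrable lborel g1"
    unfolding g1_def \<eta>_def set_integrable_def[symmetric]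
    by (rule ball_integrable) (auto intro!: continuous_intros cp)
  have g2: "integrable lborel g2"
    unfolding g2_def set_integrable_def[symmetric]
  proof (rule set_integrable_subset)
    have "continuous_on (cball 0 1 - ball 0 r) (\<lambda>x. f x * sgn x $ i)"
      unfolding sgn_div_norm using r
      by (intro continuous_intros continuous_on_subset[OF cf]) auto
    then show "set_integrable lborel (cball 0 1 - ball 0 r) (\<lambda>x. f x * sgn x $ i)"
      unfolding set_integrable_def by (intro borel_integrable_compact compact_diff) auto
  qed auto
  have "compact (f ` cball 0 1)" by (intro compact_continuous_image cf) auto
  then obtain M where M: "\<And>x. x \<in> cball 0 1 \<Longrightarrow> \<bar>f x\<bar> \<le> M"
    by (metis compact_imp_bounded bounded_iff imageI real_norm_def)
  obtain K where K: "\<And>x y. x \<in> cball 0 1 \<Longrightarrow> y \<in> cball 0 1 \<Longrightarrow> \<bar>f x - f y\<bar> \<le> K * norm (x - y)" "K \<ge> 0"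
    using smooth_on_cball_lipschitz[OF f] by blast
  have "(LINT x|lborel. g1 x - N * g2 x) = 0"
  proof (rule integral_directional_derivative_zero)
    show "\<bar>Y x - Y y\<bar> \<le> (K + N * M) * norm (x - y)" for x y
      by (rule cutoff_lipschitz[OF K M _ Y_def]) (use N in auto)
    show "norm (axis i (1::real)) = 1" by simp
    show "Y x = 0" if "norm x \<ge> 1" for x using that by (simp add: Y_def)
    show "(\<lambda>x. g1 x - N * g2 x) \<in> borel_measurable borel"
      using g1 g2 borel_measurable_integrable by fastforce
    \<comment> \<open>The cutoff may have kinks only on the spheres of radius \<open>r\<close> and
      1, which are null sets.\<close>
    show "AE x in lborel. ((\<lambda>t. Y (x + t *\<^sub>R axis i 1)) has_real_derivative g1 x - N * g2 x) (at 0)"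
      using AE_norm_neq[of r] AE_norm_neq[of 1]
    proof eventually_elim
      case (elim x)
      \<comment> \<open>Off the two spheres \<open>Y\<close> agrees locally with a differentiable
        \<open>h\<close>: with \<open>f\<close>, with a product, or with zero.\<close>
      have *: "?case" if "open U" "x \<in> U" "\<And>y. y \<in> U \<Longrightarrow> h y = Y y" "h differentiable (at x)"
        "pd i h x = g1 x - N * g2 x" for U h
        using pd_has_real_derivative[OF differentiable_cong_open[OF that(1-4)], where i=i]
          pd_cong[OF that(1-3), where i=i] that(5) by simp
      consider "norm x < r" | "r < norm x" "norm x < 1" | "norm x > 1" using elim by linarith
      then show ?case
      proof cases
        case 1
        have \<eta>1: "\<eta> y = 1" if "norm y < r" for y
          using that N Nr mult_strict_left_mono[of "1 - r" "1 - norm y" N] by (simp add: \<eta>_def)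
        show ?thesis
        proof (rule *[of "ball 0 r" f])
          show "f y = Y y" if "y \<in> ball 0 r" for y
            using that \<eta>1[of y] r by (simp add: Y_def \<eta>_def)
          show "pd i f x = g1 x - N * g2 x"
            using 1 r \<eta>1[of x] by (simp add: g1_def g2_def)
        qed (use 1 r in \<open>auto intro!: smooth_on_cball_differentiable[OF f]\<close>)
      next
        case 2
        have \<eta>2: "\<eta> y = N * (1 - norm y)" if "r < norm y" for y
          using that N Nr mult_strict_left_mono[of "1 - norm y" "1 - r" N] by (simp add: \<eta>_def)
        have x0: "x \<noteq> 0" using 2 r by auto
        have dn: "norm differentiable (at x)" using x0 by simp
        have df: "f differentiable (at x)"
          using 2 by (intro smooth_on_cball_differentiable[OF f]) auto
        have d\<eta>: "(\<lambda>y. N * (1 - norm y)) differentiable (at x)"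
          by (intro derivative_intros) (use x0 in auto)
        have p\<eta>: "pd i (\<lambda>y. N * (1 - norm y)) x = - N * (x $ i / norm x)"
          using dn x0 by (simp add: pd_cmult pd_diff pd_const pd_norm)
        show ?thesis
        proof (rule *[of "ball 0 1 - cball 0 r" "\<lambda>y. (N * (1 - norm y)) * f y"])
          show "(N * (1 - norm y)) * f y = Y y" if "y \<in> ball 0 1 - cball 0 r" for y
            using that \<eta>2[of y] by (simp add: Y_def \<eta>_def)
          show "(\<lambda>y. (N * (1 - norm y)) * f y) differentiable (at x)"
            using d\<eta> df by (rule differentiable_mult)
          show "pd i (\<lambda>y. (N * (1 - norm y)) * f y) x = g1 x - N * g2 x"
            using 2 \<eta>2[of x]
            by (subst pd_mult[OF d\<eta> df])
              (simp add: p\<eta> g1_def g2_def sgn_div_norm divide_inverse_commute)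
        qed (use 2 in auto)
      next
        case 3
        show ?thesis
        proof (rule *[of "- cball 0 1" "\<lambda>_. 0"])
        qed (use 3 in \<open>auto simp: Y_def pd_const g1_def g2_def\<close>)
      qed
    qed
  qed
  then show ?thesis
    using g1 g2 by (simp add: g1_def[abs_def] g2_def[abs_def] \<eta>_def set_lebesgue_integral_def r_def)
qed

text \<open>Limit of \<open>cutoff_divergence\<close>. The left side converges by dominated
  convergence. On the right, \<open>f\<close> is replaced by its value at the radial projection,
  after which \<open>N\<close> times the shell integral is explicit.\<close>

lemma divergence_ball_component:
  fixes f :: "real^'n::finite \<Rightarrow> real"
  assumes f: "smooth_on_cball f"
  shows "(LINT x:ball 0 1|lborel. pd i f x) = (LINT x:sphere 0 1|sphere_measure. f x * x $ i)"
proof -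
  define N where "N m = real m + 2" for m
  have N: "N m > 1" for m by (simp add: N_def)
  define r where "r m = 1 - 1 / N m" for m
  have r: "0 < r m" "r m < 1" for m using N[of m] by (auto simp: r_def)
  define S where "S m = ball (0::real^'n) 1 - ball 0 (r m)" for m
  define k where "k x = f x * x $ i" for x
  define A where "A m = (LINT x:ball 0 1|lborel. min 1 (N m * (1 - norm x)) * pd i f x)" for m
  have cf: "continuous_on (cball 0 1) f" and cp: "continuous_on (cball 0 1) (pd i f)"
    using f by (auto intro: smooth_on_cball_continuous smooth_on_cball_pd)
  have ck: "continuous_on (sphere 0 1) k"
    unfolding k_def by (intro continuous_intros continuous_on_subset[OF cf]) auto
  obtain K where K: "\<And>x y. x \<in> cball 0 1 \<Longrightarrow> y \<in> cball 0 1 \<Longrightarrow> \<bar>f x - f y\<bar> \<le> K * norm (x - y)" "K \<ge> 0"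
    using smooth_on_cball_lipschitz[OF f] by blast
  \<comment> \<open>The shell is the unit ball without the ball of radius \<open>r m\<close>, and
    both integrals are comparable by dilation.\<close>
  have shell: "(LINT x:S m|lborel. h (sgn x)) = (1 - r m ^ CARD('n)) * (LINT x:ball 0 1|lborel. h (sgn x))"
    if "continuous_on (sphere 0 1) h" for h :: "real^'n \<Rightarrow> real" and m
  proof -
    have i: "set_integrable lborel (ball 0 1) (\<lambda>x. h (sgn x))"
      by (rule comp_sgn_integrable[OF that])
    have "(LINT x:ball 0 (r m) \<union> S m|lborel. h (sgn x))
        = (LINT x:ball 0 (r m)|lborel. h (sgn x)) + (LINT x:S m|lborel. h (sgn x))"
      by (rule set_integral_Un) (use r[of m] in \<open>auto simp: S_def intro!: set_integrable_subset[OF i]\<close>)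
    also have "ball 0 (r m) \<union> S m = ball 0 1" using r[of m] by (auto simp: S_def)
    finally show ?thesis
      using integral_ball_comp_sgn[OF that, of "r m"] r[of m] by (simp add: algebra_simps)
  qed
  have "(\<lambda>m. 1 - 1 / real (m + 2)) \<longlonglongrightarrow> 1 - 0"
    by (intro tendsto_intros LIMSEQ_ignore_initial_segment[OF lim_1_over_n])
  then have rlim: "r \<longlonglongrightarrow> 1" by (simp add: r_def[abs_def] N_def add.commute)
  have rn: "(\<lambda>m. r m ^ CARD('n)) \<longlonglongrightarrow> 1"
    using tendsto_power[OF rlim, of "CARD('n)"] by simp
  \<comment> \<open>Since \<open>N m\<close> equals \<open>1 / (1 - r m)\<close>, this is the
    difference quotient of the power function with exponent \<open>CARD('n)\<close> at 1.\<close>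
  have Nrn: "(\<lambda>m. N m * (1 - r m ^ CARD('n))) \<longlonglongrightarrow> real CARD('n)"
  proof -
    have "((\<lambda>x::real. x ^ CARD('n)) has_real_derivative real CARD('n)) (at 1)"
      by (auto intro!: derivative_eq_intros)
    then have "((\<lambda>y. (y ^ CARD('n) - 1 ^ CARD('n)) / (y - 1)) \<longlongrightarrow> real CARD('n)) (at 1)"
      by (simp add: has_field_derivative_iff)
    moreover have "filterlim r (at 1) sequentially"
      unfolding filterlim_at using rlim r by (auto simp: less_imp_neq)
    ultimately have "(\<lambda>m. (r m ^ CARD('n) - 1 ^ CARD('n)) / (r m - 1)) \<longlonglongrightarrow> real CARD('n)"
      by (rule filterlim_compose)
    moreover have "(r m ^ CARD('n) - 1 ^ CARD('n)) / (r m - 1) = N m * (1 - r m ^ CARD('n))" for m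
      using N[of m] by (simp add: r_def field_simps)
    ultimately show ?thesis by simp
  qed
  \<comment> \<open>In the shell \<open>x\<close> has distance at most \<open>1 / N m\<close> from
    \<open>sgn x\<close>, so the replacement costs at most \<open>K / N m\<close> pointwise. The
    prefactor \<open>N m\<close> cancels this gain, and the remaining smallness comes from the
    volume of the shell.\<close>
  have close: "\<bar>A m - N m * (1 - r m ^ CARD('n)) * (LINT x:ball 0 1|lborel. k (sgn x))\<bar>
      \<le> K * ((1 - r m ^ CARD('n)) * (LINT x:ball (0::real^'n) 1|lborel. 1))" for m
  proof -
    have i1: "set_integrable lborel (S m) (\<lambda>x. f x * sgn x $ i)"
    proof (rule set_integrable_subset)
      have "continuous_on (cball 0 1 - ball 0 (r m)) (\<lambda>x. f x * sgn x $ i)"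
        unfolding sgn_div_norm using r[of m]
        by (intro continuous_intros continuous_on_subset[OF cf]) auto
      then show "set_integrable lborel (cball 0 1 - ball 0 (r m)) (\<lambda>x. f x * sgn x $ i)"
        unfolding set_integrable_def by (intro borel_integrable_compact compact_diff) auto
    qed (auto simp: S_def)
    have i2: "set_integrable lborel (S m) (\<lambda>x. k (sgn x))"
      by (rule set_integrable_subset[OF comp_sgn_integrable[OF ck]]) (auto simp: S_def)
    have i3: "set_integrable lborel (S m) (\<lambda>x. K / N m)"
      by (rule ball_integrable) (auto simp: S_def)
    have A: "A m = N m * (LINT x:S m|lborel. f x * sgn x $ i)"
      using cutoff_divergence[OF f N[of m], of i] by (simp add: A_def S_def r_def)
    have "\<bar>LINT x:S m|lborel. f x * sgn x $ i - k (sgn x)\<bar>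
        \<le> (LINT x:S m|lborel. norm (f x * sgn x $ i - k (sgn x)))"
      using set_integral_norm_bound[OF set_integral_diff(1)[OF i1 i2]] by simp
    also have "\<dots> \<le> (LINT x:S m|lborel. K / N m)"
    proof (rule set_integral_mono[OF set_integrable_norm[OF set_integral_diff(1)[OF i1 i2]] i3])
      fix x assume x: "x \<in> S m"
      then have nx: "r m \<le> norm x" "norm x < 1" by (auto simp: S_def)
      then have x0: "norm x \<noteq> 0" using r[of m] by linarith
      have "x - sgn x = (1 - 1 / norm x) *\<^sub>R x"
        by (simp add: sgn_div_norm divide_inverse_commute algebra_simps)
      then have "norm (x - sgn x) = \<bar>1 - 1 / norm x\<bar> * norm x" by simp
      also have "\<dots> = 1 - norm x" using x0 nx by (simp add: abs_if field_simps)
      finally have d: "norm (x - sgn x) \<le> 1 / N m" using nx by (simp add: r_def)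
      have "norm (f x * sgn x $ i - k (sgn x)) = \<bar>sgn x $ i\<bar> * \<bar>f x - f (sgn x)\<bar>"
        by (simp add: k_def left_diff_distrib[symmetric] abs_mult mult.commute)
      also have "\<dots> \<le> 1 * (K * norm (x - sgn x))"
      proof (rule mult_mono)
        show "\<bar>sgn x $ i\<bar> \<le> 1"
          using component_le_norm_cart[of "sgn x" i] x0 by (simp add: norm_sgn)
        show "\<bar>f x - f (sgn x)\<bar> \<le> K * norm (x - sgn x)"
          using nx x0 by (intro K) (auto simp: norm_sgn)
      qed auto
      also have "\<dots> \<le> K / N m" using mult_left_mono[OF d K(2)] by simp
      finally show "norm (f x * sgn x $ i - k (sgn x)) \<le> K / N m" .
    qed
    also have "\<dots> = K / N m * (LINT x:S m|lborel. 1)"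
      using set_integral_mult_right[where f="\<lambda>_. 1::real" and a="K / N m"] by simp
    also have "(LINT x:S m|lborel. 1) = (1 - r m ^ CARD('n)) * (LINT x:ball (0::real^'n) 1|lborel. 1)"
      by (rule shell) simp
    finally have b: "\<bar>LINT x:S m|lborel. f x * sgn x $ i - k (sgn x)\<bar>
      \<le> K / N m * ((1 - r m ^ CARD('n)) * (LINT x:ball (0::real^'n) 1|lborel. 1))" .
    have "A m - N m * (1 - r m ^ CARD('n)) * (LINT x:ball 0 1|lborel. k (sgn x))
        = N m * (LINT x:S m|lborel. f x * sgn x $ i - k (sgn x))"
      by (subst set_integral_diff(2)[OF i1 i2]) (simp add: A shell[OF ck] algebra_simps)
    then have "\<bar>A m - N m * (1 - r m ^ CARD('n)) * (LINT x:ball 0 1|lborel. k (sgn x))\<bar>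
        = N m * \<bar>LINT x:S m|lborel. f x * sgn x $ i - k (sgn x)\<bar>"
      using N[of m] by (simp add: abs_mult)
    also have "\<dots> \<le> N m * (K / N m * ((1 - r m ^ CARD('n)) * (LINT x:ball (0::real^'n) 1|lborel. 1)))"
      using b N[of m] by (intro mult_left_mono) auto
    also have "\<dots> = K * ((1 - r m ^ CARD('n)) * (LINT x:ball (0::real^'n) 1|lborel. 1))"
      using N[of m] by simp
    finally show ?thesis .
  qed
  have "(\<lambda>m. K * ((1 - r m ^ CARD('n)) * (LINT x:ball (0::real^'n) 1|lborel. 1))) \<longlonglongrightarrow>
      K * ((1 - 1) * (LINT x:ball (0::real^'n) 1|lborel. 1))"
    by (intro tendsto_intros rn)
  then have "(\<lambda>m. K * ((1 - r m ^ CARD('n)) * (LINT x:ball (0::real^'n) 1|lborel. 1))) \<longlonglongrightarrow> 0"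
    by simp
  then have "(\<lambda>m. A m - N m * (1 - r m ^ CARD('n)) * (LINT x:ball 0 1|lborel. k (sgn x))) \<longlonglongrightarrow> 0"
    by (rule Lim_null_comparison[OF always_eventually, rotated]) (use close in simp)
  from tendsto_add[OF this tendsto_mult_right[OF Nrn, of "LINT x:ball 0 1|lborel. k (sgn x)"]]
  have lim1: "A \<longlonglongrightarrow> real CARD('n) * (LINT x:ball 0 1|lborel. k (sgn x))" by simp
  have lim2: "A \<longlonglongrightarrow> (LINT x:ball 0 1|lborel. pd i f x)"
    unfolding A_def set_lebesgue_integral_def
  proof (rule integral_dominated_convergence)
    show "integrable lborel (\<lambda>x. norm (indicator (ball 0 1) x *\<^sub>R pd i f x))"
      using ball_integrable[OF cp, of "ball 0 1"] unfolding set_integrable_def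
      by (intro integrable_norm) auto
    show "(\<lambda>x. indicator (ball 0 1) x *\<^sub>R pd i f x) \<in> borel_measurable lborel"
      using ball_integrable[OF cp, of "ball 0 1"] unfolding set_integrable_def
      by (auto dest: borel_measurable_integrable)
    fix m
    have "set_integrable lborel (ball 0 1) (\<lambda>x. min 1 (N m * (1 - norm x)) * pd i f x)"
      by (rule ball_integrable) (auto intro!: continuous_intros cp)
    then show "(\<lambda>x. indicator (ball 0 1) x *\<^sub>R (min 1 (N m * (1 - norm x)) * pd i f x))
        \<in> borel_measurable lborel"
      unfolding set_integrable_def by (rule borel_measurable_integrable)
    show "AE x in lborel. norm (indicator (ball 0 1) x *\<^sub>R (min 1 (N m * (1 - norm x)) * pd i f x))
        \<le> norm (indicator (ball 0 1) x *\<^sub>R pd i f x)"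
    proof (rule AE_I2)
      fix x :: "real^'n"
      have "\<bar>min 1 (N m * (1 - norm x))\<bar> \<le> 1" if "norm x < 1"
      proof -
        have "0 \<le> N m * (1 - norm x)" using that N[of m] by (intro mult_nonneg_nonneg) auto
        then show ?thesis by simp
      qed
      from mult_right_mono[OF this, of "\<bar>pd i f x\<bar>"]
      show "norm (indicator (ball 0 1) x *\<^sub>R (min 1 (N m * (1 - norm x)) * pd i f x))
        \<le> norm (indicator (ball 0 1) x *\<^sub>R pd i f x)"
        by (auto simp: indicator_def abs_mult)
    qed
  next
    show "AE x in lborel. (\<lambda>m. indicator (ball 0 1) x *\<^sub>R (min 1 (N m * (1 - norm x)) * pd i f x))
        \<longlonglongrightarrow> indicator (ball 0 1) x *\<^sub>R pd i f x"
    proof (rule AE_I2)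
      fix x :: "real^'n"
      show "(\<lambda>m. indicator (ball 0 1) x *\<^sub>R (min 1 (N m * (1 - norm x)) * pd i f x))
        \<longlonglongrightarrow> indicator (ball 0 1) x *\<^sub>R pd i f x"
      proof (cases "norm x < 1")
        case True
        \<comment> \<open>From \<open>m0\<close> on, the cutoff has the value 1 at the given
          interior point.\<close>
        obtain m0 :: nat where m0: "1 / (1 - norm x) < real m0" using reals_Archimedean2 by blast
        have "N m * (1 - norm x) \<ge> 1" if "m \<ge> m0" for m
        proof -
          have "1 / (1 - norm x) \<le> N m" using m0 that by (simp add: N_def)
          then show ?thesis using True by (simp add: field_simps)
        qed
        then have "eventually (\<lambda>m. indicator (ball 0 1) x *\<^sub>R (min 1 (N m * (1 - norm x)) * pd i f x)
            = indicator (ball 0 1) x *\<^sub>R pd i f x) sequentially"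
          by (auto intro!: eventually_sequentiallyI[of m0] simp: min_def)
        then show ?thesis by (rule tendsto_eventually)
      qed simp
    qed
  qed
  have "(LINT x:ball 0 1|lborel. pd i f x) = real CARD('n) * (LINT x:ball 0 1|lborel. k (sgn x))"
    using LIMSEQ_unique[OF lim2 lim1] .
  also have "\<dots> = (LINT x:sphere 0 1|sphere_measure. k x)"
    by (rule sphere_integral_eq[OF indicator_continuous_measurable[OF ck], symmetric])
  finally show ?thesis by (simp add: k_def)
qed

lemma divergence_ball:
  fixes X :: "'n::finite \<Rightarrow> real^'n \<Rightarrow> real"
  assumes "\<And>i. smooth_on_cball (X i)"
  shows "(LINT x:ball 0 1|lborel. \<Sum>i\<in>UNIV. pd i (X i) x)
    = (LINT x:sphere 0 1|sphere_measure. \<Sum>i\<in>UNIV. X i x * x $ i)"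
proof -
  have 1: "set_integrable lborel (ball 0 1) (pd i (X i))" for i
    by (rule ball_integrable) (auto intro!: smooth_on_cball_continuous smooth_on_cball_pd assms)
  have 2: "set_integrable sphere_measure (sphere 0 1) (\<lambda>x. X i x * x $ i)" for i
    by (intro sphere_integrable continuous_intros
        continuous_on_subset[OF smooth_on_cball_continuous[OF assms]]) auto
  have "(LINT x:ball 0 1|lborel. \<Sum>i\<in>UNIV. pd i (X i) x)
      = (\<Sum>i\<in>UNIV. LINT x:ball 0 1|lborel. pd i (X i) x)"
    unfolding set_lebesgue_integral_def scaleR_sum_right
    by (rule Bochner_Integration.integral_sum) (rule 1[unfolded set_integrable_def])
  also have "\<dots> = (\<Sum>i\<in>UNIV. LINT x:sphere 0 1|sphere_measure. X i x * x $ i)"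
    by (simp only: divergence_ball_component[OF assms])
  also have "\<dots> = (LINT x:sphere 0 1|sphere_measure. \<Sum>i\<in>UNIV. X i x * x $ i)"
    unfolding set_lebesgue_integral_def scaleR_sum_right
    by (rule Bochner_Integration.integral_sum[symmetric]) (rule 2[unfolded set_integrable_def])
  finally show ?thesis .
qed

section \<open>Curvature of conformally flat metrics\<close>

lemma scaleR_mat_1_nth: "(c *\<^sub>R mat 1 :: real^'n::finite^'n) $ i $ j = (if i = j then c else 0)"
  by (simp add: mat_def)

text \<open>\<open>matrix_inv\<close> is defined by choice; multiplication by an explicit two-sided
  inverse shows what was chosen.\<close>

lemma matrix_inv_scaleR_mat_1:
  assumes "c \<noteq> 0"
  shows "matrix_inv (c *\<^sub>R mat 1 :: real^'n::finite^'n) = inverse c *\<^sub>R mat 1"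
proof -
  let ?A = "c *\<^sub>R mat 1 :: real^'n::finite^'n" and ?B = "inverse c *\<^sub>R mat 1 :: real^'n::finite^'n"
  have AB: "?A ** ?B = mat 1" "?B ** ?A = mat 1"
    using assms by (simp_all add: matrix_scalar_ac flip: scalar_matrix_assoc)
  then have "?A ** matrix_inv ?A = mat 1"
    unfolding matrix_inv_def by (metis (mono_tags, lifting) someI_ex)
  then have "?B ** (?A ** matrix_inv ?A) = ?B" by simp
  then show ?thesis using AB by (simp add: matrix_mul_assoc)
qed

lemma det_scaleR_mat_1: "det (c *\<^sub>R mat 1 :: real^'n::finite^'n) = c ^ CARD('n)"
  by (subst det_diagonal) (simp_all add: mat_def)

lemma scaleR_mat_1_mult_vec: "(c *\<^sub>R mat 1 :: real^'n::finite^'n) *v x = c *\<^sub>R x"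
  by (metis matrix_vector_mul_lid scaleR_matrix_vector_assoc)

lemma sum_if_const: "(\<Sum>l\<in>A. if c then f l else (0::real)) = (if c then sum f A else 0)"
  by simp

section \<open>Connection and scalar curvature of a conformal metric near the closed ball\<close>

locale conformal_nhd =
  fixes u :: "real^'n::finite \<Rightarrow> real" and U
  assumes card: "CARD('n) \<ge> 3"
    and U: "open U" "cball 0 1 \<subseteq> U" and smooth: "\<And>k. Ck_on k U u"
    and pos: "\<And>x. x \<in> U \<Longrightarrow> u x > 0"
begin

definition \<beta> :: real where "\<beta> = 2 / (real CARD('n) - 2)"

text \<open>With \<phi> = \<beta> log u the metric is exp(2 \<phi>) times the flat one, and
  \<open>p\<close> is the gradient of \<phi>.\<close>

definition p :: "'n \<Rightarrow> real^'n \<Rightarrow> real" where "p i x = \<beta> * (pd i u x * inverse (u x))"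

definition lap :: "real^'n \<Rightarrow> real" where "lap x = (\<Sum>i\<in>UNIV. pd i (pd i u) x)"

abbreviation G :: "'n metric" where "G \<equiv> conformal_metric u"

lemma G_eq: "G x = (u x powr (2 * \<beta>)) *\<^sub>R mat 1"
  by (simp add: conformal_metric_def flat_metric_def \<beta>_def)

lemma G_nth: "G x $ i $ j = (if i = j then u x powr (2 * \<beta>) else 0)"
  by (simp only: G_eq scaleR_mat_1_nth)

lemma matrix_inv_G: "x \<in> U \<Longrightarrow> matrix_inv (G x) = (u x powr (- 2 * \<beta>)) *\<^sub>R mat 1"
  unfolding G_eq using pos[of x]
  by (subst matrix_inv_scaleR_mat_1) (auto simp: powr_minus)

lemma matrix_inv_G_nth:
  "x \<in> U \<Longrightarrow> matrix_inv (G x) $ i $ j = (if i = j then u x powr (- 2 * \<beta>) else 0)"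
  by (simp only: matrix_inv_G scaleR_mat_1_nth)

lemma u_diff: "x \<in> U \<Longrightarrow> u differentiable (at x)"
  using smooth[of 1] U(1) by (auto simp: differentiable_on_eq_differentiable_at)

lemma pd_u_diff: "x \<in> U \<Longrightarrow> pd i u differentiable (at x)"
  using smooth[of 2] U(1) by (auto simp: differentiable_on_eq_differentiable_at numeral_2_eq_2)

lemma p_diff: "x \<in> U \<Longrightarrow> p i differentiable (at x)"
  unfolding p_def using pd_u_diff[of x i] u_diff[of x] pos[of x]
  by (intro differentiable_mult differentiable_const differentiable_inverse) auto

lemma pd_p:
  assumes "x \<in> U"
  shows "pd j (p i) x = \<beta> * (pd j (pd i u) x / u x - pd i u x * pd j u x / (u x)\<^sup>2)"
proof -
  have u: "u differentiable (at x)" "u x \<noteq> 0" using u_diff pos[OF assms] assms by auto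
  then have d: "(\<lambda>y. inverse (u y)) differentiable (at x)" by (rule differentiable_inverse)
  have "pd j (p i) x = \<beta> * pd j (\<lambda>y. pd i u y * inverse (u y)) x"
    unfolding p_def[abs_def]
    by (rule pd_cmult) (intro differentiable_mult pd_u_diff d assms)
  then show ?thesis
    unfolding pd_mult[OF pd_u_diff[OF assms] d] pd_inverse[OF u]
    by (simp add: divide_inverse algebra_simps)
qed

lemma pd_G:
  assumes "x \<in> U"
  shows "pd i (\<lambda>y. G y $ j $ l) x = (if j = l then 2 * u x powr (2 * \<beta>) * p i x else 0)"
proof (cases "j = l")
  case True
  have "pd i (\<lambda>y. G y $ j $ l) x = pd i (\<lambda>y. u y powr (2 * \<beta>)) x"
    using True by (simp add: G_nth)
  also have "\<dots> = 2 * \<beta> * u x powr (2 * \<beta> - 1) * pd i u x"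
    using assms by (simp add: pd_powr u_diff pos)
  also have "u x powr (2 * \<beta> - 1) = u x powr (2 * \<beta>) * inverse (u x)"
    using pos[OF assms] by (simp add: powr_diff divide_inverse)
  finally show ?thesis using True by (simp add: p_def)
qed (simp add: G_nth pd_const)

text \<open>Classical formula for a metric exp(2 \<phi>) times the flat one: the conformal factor
  cancels against the inverse metric, and only derivatives of \<phi> remain.\<close>

lemma christoffel_G:
  assumes "x \<in> U"
  shows "christoffel G k i j x =
    (if j = k then p i x else 0) + (if i = k then p j x else 0) - (if i = j then p k x else 0)"
proof -
  have "u x powr (- 2 * \<beta>) * u x powr (2 * \<beta>) = 1"
    using pos[OF assms] by (simp add: powr_add[symmetric])
  then have e: "u x powr (- 2 * \<beta>) * (2 * u x powr (2 * \<beta>) * z) = 2 * z" for z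
    by (metis mult.assoc mult.left_commute mult_1)
  have "christoffel G k i j x = (1/2) * (u x powr (- 2 * \<beta>) *
     (pd i (\<lambda>y. G y $ j $ k) x + pd j (\<lambda>y. G y $ i $ k) x - pd k (\<lambda>y. G y $ i $ j) x))"
    unfolding christoffel_def matrix_inv_G_nth[OF assms]
    by (simp add: if_distrib[of "\<lambda>z. z * _"] cong: if_cong)
  also have "\<dots> = (if j = k then p i x else 0) + (if i = k then p j x else 0) - (if i = j then p k x else 0)"
    unfolding pd_G[OF assms] distrib_left right_diff_distrib
    by (simp only: e if_distrib[of "\<lambda>z. u x powr (- 2 * \<beta>) * z"] if_distrib[of "\<lambda>z. 1/2 * z"] mult_zero_right)
      simp
  finally show ?thesis .
qed

lemma pd_christoffel_G:
  assumes "x \<in> U"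
  shows "pd m (christoffel G k i j) x = (if j = k then pd m (p i) x else 0)
    + (if i = k then pd m (p j) x else 0) - (if i = j then pd m (p k) x else 0)"
proof -
  have d: "(\<lambda>y. if c then p l y else 0) differentiable (at x)" for c l
    using p_diff[OF assms] by (cases c) auto
  have q: "pd m (\<lambda>y. if c then p l y else 0) x = (if c then pd m (p l) x else 0)" for c l
    by (cases c) (auto simp: pd_const)
  have "pd m (christoffel G k i j) x = pd m (\<lambda>y. (if j = k then p i y else 0)
    + (if i = k then p j y else 0) - (if i = j then p k y else 0)) x"
    by (rule pd_cong[OF U(1) assms christoffel_G])
  also have "\<dots> = (if j = k then pd m (p i) x else 0)
    + (if i = k then pd m (p j) x else 0) - (if i = j then pd m (p k) x else 0)"
    by (subst pd_diff[OF differentiable_add[OF d d] d], subst pd_add[OF d d]) (simp only: q)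
  finally show ?thesis .
qed

text \<open>Classical expression - 2 (n - 1) \<Delta>\<phi> - (n - 1) (n - 2) |grad \<phi>|^2. The
  trace is Euclidean; the power of \<open>u\<close> from the inverse metric is added in
  \<open>scalar_curvature_G\<close>.\<close>

lemma trace_ricci_G:
  assumes x: "x \<in> U"
  shows "(\<Sum>i\<in>UNIV. ricci G i i x) = - 2 * (real CARD('n) - 1) * (\<Sum>i\<in>UNIV. pd i (p i) x)
    - (real CARD('n) - 1) * (real CARD('n) - 2) * (\<Sum>i\<in>UNIV. (p i x)\<^sup>2)"
proof -
  define P where "P i = p i x" for i
  define Q where "Q = (\<Sum>i\<in>UNIV. (P i)\<^sup>2)"
  define D where "D = (\<Sum>i\<in>UNIV. pd i (p i) x)"
  have 1: "pd k (christoffel G k i i) x - pd i (christoffel G k i k) x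
      = (if i = k then 2 * pd i (p i) x else 0) - pd k (p k) x - pd i (p i) x" for i k
    by (simp add: pd_christoffel_G[OF x])
  \<comment> \<open>All products reduce to squares of single components times Kronecker deltas, so
    the triple sum collapses to multiples of \<open>Q\<close>.\<close>
  have 2: "christoffel G k k l x * christoffel G l i i x
        - christoffel G k i l x * christoffel G l i k x
      = (if i = l then 2 * (P i)\<^sup>2 else 0) - (P l)\<^sup>2 - (if l = k then (P i)\<^sup>2 else 0)
        + (if i = k then (P l)\<^sup>2 else 0) + (if i = l then (P k)\<^sup>2 else 0)
        - (if i = l then (if i = k then 2 * (P i)\<^sup>2 else 0) else 0)" for i k l
    unfolding christoffel_G[OF x] P_def by (auto simp: power2_eq_square algebra_simps)
  have "(\<Sum>i\<in>UNIV. ricci G i i x)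
      = (\<Sum>i\<in>UNIV. \<Sum>k\<in>UNIV. (if i = k then 2 * pd i (p i) x else 0) - pd k (p k) x - pd i (p i) x
      + (\<Sum>l\<in>UNIV. (if i = l then 2 * (P i)\<^sup>2 else 0) - (P l)\<^sup>2 - (if l = k then (P i)\<^sup>2 else 0)
        + (if i = k then (P l)\<^sup>2 else 0) + (if i = l then (P k)\<^sup>2 else 0)
        - (if i = l then (if i = k then 2 * (P i)\<^sup>2 else 0) else 0)))"
    unfolding ricci_def 1 2 ..
  also have "\<dots> = 2 * D - 2 * real CARD('n) * D
      + (2 * real CARD('n) * Q - (real CARD('n))\<^sup>2 * Q - real CARD('n) * Q + real CARD('n) * Q
         + real CARD('n) * Q - 2 * Q)"
    by (simp add: sum.distrib sum_subtractf sum_if_const sum_distrib_left[symmetric]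
        power2_eq_square[of "real CARD('n)"] algebra_simps flip: Q_def D_def)
  also have "\<dots> = - 2 * (real CARD('n) - 1) * D - (real CARD('n) - 1) * (real CARD('n) - 2) * Q"
    by (simp add: algebra_simps power2_eq_square)
  finally show ?thesis unfolding Q_def D_def P_def .
qed

lemma \<beta>_mult: "(real CARD('n) - 2) * \<beta> = 2" and \<beta>_pos: "\<beta> > 0"
proof -
  have "real CARD('n) - 2 > 0" using card by linarith
  then show "\<beta> > 0" by (simp add: \<beta>_def)
  show "(real CARD('n) - 2) * \<beta> = 2"
    unfolding \<beta>_def times_divide_eq_right
    by (rule nonzero_mult_div_cancel_left) (use card in linarith)
qed

text \<open>This is the transformation law of the scalar curvature over the flat metric; the
  exponent equals -(n + 2)/(n - 2). The power of \<open>u\<close> defining the metric is the one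
  with (n - 2) \<beta> = 2, for which the squared gradients cancel and only the Laplacian of
  \<open>u\<close> survives.\<close>

lemma scalar_curvature_G:
  assumes x: "x \<in> U"
  shows "c_const CARD('n) * scalar_curvature G x = - lap x * u x powr (- 2 * \<beta> - 1)"
proof -
  let ?n = "real CARD('n)"
  let ?g = "\<Sum>i\<in>UNIV. (pd i u x)\<^sup>2"
  have ux: "u x > 0" using pos[OF x] .
  have "(\<Sum>i\<in>UNIV. pd i (p i) x) = \<beta> * (lap x / u x - ?g / (u x)\<^sup>2)"
    by (simp add: pd_p[OF x] lap_def sum_distrib_left[symmetric] sum_subtractf
        sum_divide_distrib power2_eq_square)
  moreover have "(\<Sum>i\<in>UNIV. (p i x)\<^sup>2) = \<beta>\<^sup>2 * ?g / (u x)\<^sup>2"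
  proof -
    have "(p i x)\<^sup>2 = \<beta>\<^sup>2 / (u x)\<^sup>2 * (pd i u x)\<^sup>2" for i
      by (simp add: p_def power_mult_distrib divide_inverse power_inverse)
    then have "(\<Sum>i\<in>UNIV. (p i x)\<^sup>2) = \<beta>\<^sup>2 / (u x)\<^sup>2 * ?g"
      by (simp only: sum_distrib_left)
    then show ?thesis by simp
  qed
  ultimately have "(\<Sum>i\<in>UNIV. ricci G i i x)
      = - 2 * (?n - 1) * (\<beta> * (lap x / u x - ?g / (u x)\<^sup>2)) - (?n - 1) * ((?n - 2) * \<beta>) * \<beta> * (?g / (u x)\<^sup>2)"
    unfolding trace_ricci_G[OF x] by (simp add: power2_eq_square)
  also have "\<dots> = - 2 * (?n - 1) * \<beta> * (lap x / u x)"
  proof -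
    have "- 2 * m * (\<beta> * (a - b)) - m * 2 * \<beta> * b = - 2 * m * \<beta> * a" for m a b :: real
      by (simp add: algebra_simps)
    then show ?thesis unfolding \<beta>_mult .
  qed
  finally have tr: "(\<Sum>i\<in>UNIV. ricci G i i x) = - 2 * (?n - 1) * \<beta> * (lap x / u x)" .
  have R: "scalar_curvature G x = u x powr (- 2 * \<beta>) * (\<Sum>i\<in>UNIV. ricci G i i x)"
    unfolding scalar_curvature_def matrix_inv_G_nth[OF x] sum_distrib_left
    by (simp add: if_distrib[of "\<lambda>z. z * _"] cong: if_cong)
  have c: "c_const CARD('n) * (2 * (?n - 1) * \<beta>) = 1"
  proof -
    have "k / (4 * m) * (2 * m * (2 / k)) = 1" if "k \<noteq> 0" "m \<noteq> 0" for k m :: real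
      using that by simp
    then show ?thesis unfolding c_const_def \<beta>_def using card by simp
  qed
  have "c_const CARD('n) * scalar_curvature G x
      = - (c_const CARD('n) * (2 * (?n - 1) * \<beta>)) * lap x * (u x powr (- 2 * \<beta>) / u x)"
    unfolding R tr by (simp only: divide_inverse mult_minus_left mult_minus_right mult_ac)
  also have "u x powr (- 2 * \<beta>) / u x = u x powr (- 2 * \<beta> - 1)"
    using ux by (simp add: powr_diff)
  finally show ?thesis unfolding c by simp
qed

section \<open>Normal, mean curvature and densities of a conformal metric\<close>

lemma conorm2_G: "x \<in> U \<Longrightarrow> conorm2 G x \<xi> = u x powr (- 2 * \<beta>) * (norm \<xi>)\<^sup>2"
  unfolding conorm2_def matrix_inv_G scaleR_mat_1_mult_vec
  by (simp add: power2_norm_eq_inner)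

text \<open>Points off the sphere are included because the mean curvature differentiates the
  normal.\<close>

lemma outer_normal_G:
  assumes "x \<in> U" "x \<noteq> 0"
  shows "outer_normal G x $ k = u x powr (- \<beta>) * (inverse (norm x) * x $ k)"
proof -
  have ux: "u x > 0" using pos assms by auto
  have q: "u x powr (- 2 * \<beta>) = (u x powr (- \<beta>))\<^sup>2"
    by (simp add: power2_eq_square powr_add[symmetric])
  define z where "z = u x powr (- \<beta>)"
  have z: "z > 0" using ux by (simp add: z_def)
  have "sqrt (conorm2 G x x) = z * norm x"
    unfolding conorm2_G[OF assms(1)] q z_def[symmetric] using z by (simp add: real_sqrt_mult)
  then show ?thesis
    unfolding outer_normal_def matrix_inv_G[OF assms(1)] scaleR_mat_1_mult_vec q z_def[symmetric]
    using z by (simp add: power2_eq_square divide_inverse)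
qed

lemma pd_outer_normal_G:
  assumes x: "norm x = 1"
  shows "pd i (\<lambda>y. outer_normal G y $ i) x = u x powr (- \<beta>) * (1 - (x $ i)\<^sup>2 - p i x * x $ i)"
proof -
  have xU: "x \<in> U" and x0: "x \<noteq> 0" using x U(2) by auto
  have ux: "u x > 0" using pos xU by auto
  have dn: "norm differentiable (at x)" using x0 by simp
  have nx: "norm x \<noteq> 0" using x0 by simp
  have d1: "(\<lambda>y. inverse (norm y)) differentiable (at x)"
    using dn nx by (rule differentiable_inverse)
  have d2: "(\<lambda>y. y $ i) differentiable (at x)"
    by (rule bounded_linear_imp_differentiable) (rule bounded_linear_vec_nth)
  have d3: "(\<lambda>y. u y powr (- \<beta>)) differentiable (at x)"
    using u_diff xU ux by (intro differentiable_powr_const)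
  have "pd i (\<lambda>y. outer_normal G y $ i) x = pd i (\<lambda>y. u y powr (- \<beta>) * (inverse (norm y) * y $ i)) x"
    by (rule pd_cong[of "U - {0}"]) (use U(1) xU x0 outer_normal_G in auto)
  also have "\<dots> = u x powr (- \<beta>) * (1 - (x $ i)\<^sup>2) + (- \<beta>) * u x powr (- \<beta> - 1) * pd i u x * x $ i"
    by (subst pd_mult[OF d3 differentiable_mult[OF d1 d2]], subst pd_mult[OF d1 d2],
        subst pd_powr[OF u_diff[OF xU] ux], subst pd_inverse[OF dn nx])
      (use x x0 in \<open>auto simp: pd_component pd_norm power2_eq_square\<close>)
  also have "u x powr (- \<beta> - 1) = u x powr (- \<beta>) * inverse (u x)"
    using ux by (simp add: powr_diff divide_inverse)
  finally show ?thesis by (simp add: p_def algebra_simps)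
qed

text \<open>The contracted Christoffel terms contribute n times the normal component of
  \<open>p\<close>, and the derivative of the normal takes one of these away. The factor n - 1
  obtained is the one in the normalisation of the mean curvature; b_n \<beta> = 1 does the
  rest.\<close>

lemma mean_curvature_G:
  assumes x: "norm x = 1"
  shows "b_const CARD('n) * mean_curvature G x
    = u x powr (- \<beta> - 1) * (b_const CARD('n) * u x + (\<Sum>i\<in>UNIV. pd i u x * x $ i))"
proof -
  let ?n = "real CARD('n)"
  let ?s = "\<Sum>i\<in>UNIV. p i x * x $ i"
  have xU: "x \<in> U" and x0: "x \<noteq> 0" using x U(2) by auto
  have ux: "u x > 0" using pos xU by auto
  have n1: "(\<Sum>i\<in>UNIV. (x $ i)\<^sup>2) = 1"
    using x by (simp add: norm_eq_1 inner_vec_def power2_eq_square)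
  have "normal_cov_deriv G i i x
      = u x powr (- \<beta>) * (1 - (x $ i)\<^sup>2 - p i x * x $ i) + u x powr (- \<beta>) * ?s" for i
  proof -
    have "christoffel G i i j x = p j x" for j unfolding christoffel_G[OF xU] by auto
    then show ?thesis
      unfolding normal_cov_deriv_def pd_outer_normal_G[OF x] outer_normal_G[OF xU x0]
      by (simp add: x sum_distrib_left algebra_simps)
  qed
  then have "(\<Sum>i\<in>UNIV. normal_cov_deriv G i i x)
      = u x powr (- \<beta>) * (?n - (\<Sum>i\<in>UNIV. (x $ i)\<^sup>2) - ?s) + ?n * (u x powr (- \<beta>) * ?s)"
    by (simp add: sum.distrib sum_subtractf sum_distrib_left[symmetric])
  also have "\<dots> = (?n - 1) * (u x powr (- \<beta>) * (1 + ?s))"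
    unfolding n1 by (simp add: algebra_simps)
  finally have "mean_curvature G x = u x powr (- \<beta>) * (1 + ?s)"
    using card by (simp add: mean_curvature_def)
  moreover have "?s = \<beta> * (\<Sum>i\<in>UNIV. pd i u x * x $ i) / u x"
    using ux by (simp add: p_def sum_distrib_left sum_divide_distrib divide_inverse mult.assoc mult.commute mult.left_commute)
  ultimately have "b_const CARD('n) * mean_curvature G x = u x powr (- \<beta>)
      * (b_const CARD('n) + (b_const CARD('n) * \<beta>) * (\<Sum>i\<in>UNIV. pd i u x * x $ i) / u x)"
    by (simp add: algebra_simps)
  also have "b_const CARD('n) * \<beta> = 1"
    using card by (simp add: b_const_def \<beta>_def)
  also have "u x powr (- \<beta>) * (b_const CARD('n) + 1 * (\<Sum>i\<in>UNIV. pd i u x * x $ i) / u x)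
      = u x powr (- \<beta>) / u x * (b_const CARD('n) * u x + (\<Sum>i\<in>UNIV. pd i u x * x $ i))"
    using ux by (simp add: field_simps)
  also have "u x powr (- \<beta>) / u x = u x powr (- \<beta> - 1)"
    using ux by (simp add: powr_diff)
  finally show ?thesis .
qed

text \<open>The total power 2 (n - 1)/(n - 2) is split as 2 + \<beta>: the square of
  \<open>u\<close> will turn the square of v / u into that of v, leaving the weight
  \<open>u x powr \<beta>\<close>. The volume density is split likewise.\<close>

lemma area_density_G:
  assumes "norm x = 1"
  shows "area_density G x = (u x)\<^sup>2 * u x powr \<beta>"
proof -
  have xU: "x \<in> U" using assms U(2) by auto
  have ux: "u x > 0" using pos xU by auto
  have e: "\<beta> * real CARD('n) = 2 + 2 * \<beta>" using \<beta>_mult by (simp add: algebra_simps)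
  have "det (G x) * conorm2 G x x = u x powr (2 * \<beta> * real CARD('n) - 2 * \<beta>)"
    using assms ux unfolding conorm2_G[OF xU] unfolding G_eq det_scaleR_mat_1
    by (simp add: powr_power powr_add[symmetric] algebra_simps)
  also have "2 * \<beta> * real CARD('n) - 2 * \<beta> = 2 + 2 + \<beta> + \<beta>" using e by simp
  also have "u x powr \<dots> = ((u x)\<^sup>2 * u x powr \<beta>)\<^sup>2"
    using ux unfolding powr_add by (simp add: power2_eq_square)
  finally show ?thesis using ux by (simp add: area_density_def)
qed

lemma vol_density_G:
  assumes "x \<in> U"
  shows "vol_density G x = (u x)\<^sup>2 * u x powr (2 * \<beta>)"
proof -
  have ux: "u x > 0" using pos assms by auto
  have e: "\<beta> * real CARD('n) = 2 + 2 * \<beta>" using \<beta>_mult by (simp add: algebra_simps)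
  have "det (G x) = u x powr (2 * (\<beta> * real CARD('n)))"
    unfolding G_eq det_scaleR_mat_1 using ux by (simp add: powr_power algebra_simps)
  also have "2 * (\<beta> * real CARD('n)) = 2 + 2 + 2 * \<beta> + 2 * \<beta>" using e by simp
  also have "u x powr \<dots> = ((u x)\<^sup>2 * u x powr (2 * \<beta>))\<^sup>2"
    using ux unfolding powr_add by (simp add: power2_eq_square)
  finally show ?thesis using ux by (simp add: vol_density_def)
qed

end

section \<open>The first eigenvalue\<close>

text \<open>The constant sequence \<open>f\<close> approximates. Extension by zero makes the
  functions Borel on the whole space, as \<open>f\<close> is arbitrary far from the ball.\<close>

lemma H1_with_trace_smooth:
  fixes f :: "real^'n::finite \<Rightarrow> real"
  assumes f: "smooth_on_cball f"
  defines "w \<equiv> \<lambda>x. if x \<in> cball 0 1 then f x else 0"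
  defines "F \<equiv> \<lambda>x. if x \<in> cball 0 1 then grad f x else 0"
  shows "H1_with_trace w F w"
proof -
  have cf: "continuous_on (cball 0 1) f" and cg: "continuous_on (cball 0 1) (grad f)"
    using f by (rule smooth_on_cball_continuous, rule smooth_on_cball_grad_continuous)
  have wm: "w \<in> borel_measurable borel" and Fm: "F \<in> borel_measurable borel"
    unfolding w_def F_def
    by (rule borel_measurable_continuous_on_if; use cf cg in simp)+
  have cw: "continuous_on (cball 0 1) w" and cF: "continuous_on (cball 0 1) F"
    by (rule continuous_on_eq[OF cf], simp add: w_def, rule continuous_on_eq[OF cg], simp add: F_def)
  have "set_integrable lborel (ball 0 1) (\<lambda>x. (w x)\<^sup>2)"
    by (rule ball_integrable) (auto intro!: continuous_intros cw)
  moreover have "set_integrable lborel (ball 0 1) (\<lambda>x. (norm (F x))\<^sup>2)"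
    by (rule ball_integrable) (auto intro!: continuous_intros cF)
  moreover have "set_integrable sphere_measure (sphere 0 1) (\<lambda>x. (w x)\<^sup>2)"
    by (rule sphere_integrable) (auto intro!: continuous_intros continuous_on_subset[OF cw])
  moreover have "(LINT x:ball 0 1|lborel. (f x - w x)\<^sup>2) = (LINT x:ball (0::real^'n) 1|lborel. 0)"
    "(LINT x:ball 0 1|lborel. (norm (grad f x - F x))\<^sup>2) = (LINT x:ball (0::real^'n) 1|lborel. 0)"
    "(LINT x:sphere 0 1|sphere_measure. (f x - w x)\<^sup>2) = (LINT x:sphere (0::real^'n) 1|sphere_measure. 0)"
    by (rule set_lebesgue_integral_cong; simp add: w_def F_def)+
  ultimately show ?thesis
    unfolding H1_with_trace_def using wm Fm f
    by (intro conjI exI[of _ "\<lambda>_. f"]) simp_all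
qed

lemma (in conformal_nhd) conformal_factor: "u \<in> conformal_factors"
proof -
  have "smooth_on_cball u" unfolding smooth_on_cball_def using U smooth by blast
  then show ?thesis using U(2) pos unfolding conformal_factors_def by blast
qed

text \<open>The conformal covariance of the energy: with \<open>w = v / u\<close>, the energy density of \<open>w\<close> for the
  conformal metric differs from \<open>|grad v|\<^sup>2\<close> by the divergence of \<open>u w\<^sup>2 grad u\<close>.\<close>

lemma (in conformal_nhd) test_function:
  assumes v: "smooth_on_cball v"
  obtains w F where "H1_with_trace w F w"
    "energy G w F w = (LINT x:ball 0 1|lborel. (norm (grad v x))\<^sup>2)
      + b_const CARD('n) * (LINT x:sphere 0 1|sphere_measure. (v x)\<^sup>2)"
    "boundary_norm2 G w = (LINT x:sphere 0 1|sphere_measure. (v x)\<^sup>2 * u x powr \<beta>)"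
proof -
  \<comment> \<open>Division by \<open>u\<close> is written as a power, so that
    \<open>smooth_on_cball_powr\<close> applies.\<close>
  define W where "W x = v x * u x powr (-1)" for x
  define w where "w = (\<lambda>x. if x \<in> cball 0 1 then W x else 0)"
  define F where "F = (\<lambda>x. if x \<in> cball 0 1 then grad W x else 0)"
  define X where "X i x = (u x * (W x * W x)) * pd i u x" for i x
  have su: "smooth_on_cball u" using conformal_factor by (simp add: conformal_factors_def)
  have sW: "smooth_on_cball W"
    unfolding W_def[abs_def] by (intro smooth_on_cball_mult v smooth_on_cball_powr conformal_factor)
  have sX: "smooth_on_cball (X i)" for i
    unfolding X_def[abs_def] by (intro smooth_on_cball_mult su sW smooth_on_cball_pd)
  have Wu: "v x = W x * u x" if "x \<in> U" for x
    using pos[OF that] by (simp add: W_def powr_minus_divide)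
  have dW: "W differentiable (at x)" and du: "u differentiable (at x)"
    and dpu: "pd i u differentiable (at x)" if "x \<in> cball 0 1" for x i
    using that by (rule smooth_on_cball_differentiable[rotated]; intro sW su smooth_on_cball_pd)+
  have pv: "pd i v x = W x * pd i u x + pd i W x * u x" if "x \<in> cball 0 1" for i x
  proof -
    have "pd i v x = pd i (\<lambda>x. W x * u x) x"
      by (rule pd_cong[OF U(1) _ Wu]) (use that U(2) in auto)
    also have "\<dots> = W x * pd i u x + pd i W x * u x"
      by (rule pd_mult[OF dW du]) (use that in auto)
    finally show ?thesis .
  qed
  have pX: "pd i (X i) x = u x * (W x)\<^sup>2 * pd i (pd i u) x + 2 * u x * W x * pd i W x * pd i u x
      + (W x)\<^sup>2 * (pd i u x)\<^sup>2" if x: "x \<in> cball 0 1" for i x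
  proof -
    note d = dW[OF x] du[OF x] dpu[OF x]
    show ?thesis unfolding X_def[abs_def]
      by (simp add: pd_mult differentiable_mult d power2_eq_square algebra_simps)
  qed
  \<comment> \<open>Expanding the gradient of \<open>v = W u\<close> and the divergence of
    \<open>X\<close>, the mixed terms and the squares of grad u agree. What remains is u^2 |grad
    W|^2 - u W^2 \<Delta>u, the energy density of \<open>w\<close>.\<close>
  have inner: "(conorm2 G x (F x) + c_const CARD('n) * scalar_curvature G x * (w x)\<^sup>2) * vol_density G x
      = (norm (grad v x))\<^sup>2 - (\<Sum>i\<in>UNIV. pd i (X i) x)" if x: "x \<in> ball 0 1" for x
  proof -
    have xc: "x \<in> cball 0 1" and xU: "x \<in> U" using x U(2) by auto
    have ux: "u x > 0" using pos[OF xU] .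
    have e1: "u x powr (- 2 * \<beta>) * u x powr (2 * \<beta>) = 1"
      using ux by (simp add: powr_add[symmetric])
    have e2: "u x powr (- 2 * \<beta> - 1) * (u x powr (2 * \<beta>) * u x) = 1"
      using ux by (simp add: powr_diff powr_minus)
    have "(conorm2 G x (F x) + c_const CARD('n) * scalar_curvature G x * (w x)\<^sup>2) * vol_density G x
        = (u x powr (- 2 * \<beta>) * u x powr (2 * \<beta>)) * (u x)\<^sup>2 * (norm (grad W x))\<^sup>2
          - (u x powr (- 2 * \<beta> - 1) * (u x powr (2 * \<beta>) * u x)) * u x * (W x)\<^sup>2 * lap x"
      unfolding conorm2_G[OF xU] scalar_curvature_G[OF xU] vol_density_G[OF xU]
      using xc by (simp add: w_def F_def algebra_simps power2_eq_square)
    also have "\<dots> = (\<Sum>i\<in>UNIV. (u x)\<^sup>2 * (pd i W x)\<^sup>2 - u x * (W x)\<^sup>2 * pd i (pd i u) x)"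
      unfolding e1 e2 norm_grad_sq lap_def by (simp add: sum_subtractf sum_distrib_left)
    also have "\<dots> = (\<Sum>i\<in>UNIV. (pd i v x)\<^sup>2 - pd i (X i) x)"
      unfolding pv[OF xc] pX[OF xc]
      by (intro sum.cong refl) (simp add: power2_eq_square algebra_simps)
    finally show ?thesis by (simp add: norm_grad_sq sum_subtractf)
  qed
  \<comment> \<open>The mean curvature contributes the normal derivative of \<open>u\<close>, that
    is, the flux of \<open>X\<close> through the sphere. It will cancel the divergence of
    \<open>X\<close> from the interior.\<close>
  have bdry: "b_const CARD('n) * (mean_curvature G x * (w x)\<^sup>2 * area_density G x)
      = b_const CARD('n) * (v x)\<^sup>2 + (\<Sum>i\<in>UNIV. X i x * x $ i)" if x: "x \<in> sphere 0 1" for x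
  proof -
    have nx: "norm x = 1" and xc: "x \<in> cball 0 1" and xU: "x \<in> U" using x U(2) by auto
    have ux: "u x > 0" using pos[OF xU] .
    have e: "u x powr (- \<beta> - 1) * (u x powr \<beta> * u x) = 1"
      using ux by (simp add: powr_diff powr_minus)
    have "b_const CARD('n) * (mean_curvature G x * (w x)\<^sup>2 * area_density G x)
        = (b_const CARD('n) * mean_curvature G x) * ((W x)\<^sup>2 * ((u x)\<^sup>2 * u x powr \<beta>))"
      using xc by (simp add: w_def area_density_G[OF nx])
    also have "\<dots> = (u x powr (- \<beta> - 1) * (u x powr \<beta> * u x)) * (u x * (W x)\<^sup>2
        * (b_const CARD('n) * u x + (\<Sum>i\<in>UNIV. pd i u x * x $ i)))"
      unfolding mean_curvature_G[OF nx] by (simp only: power2_eq_square mult_ac)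
    also have "\<dots> = b_const CARD('n) * (v x)\<^sup>2 + u x * (W x)\<^sup>2 * (\<Sum>i\<in>UNIV. pd i u x * x $ i)"
      unfolding e Wu[OF xU] by (simp add: power2_eq_square algebra_simps)
    also have "u x * (W x)\<^sup>2 * (\<Sum>i\<in>UNIV. pd i u x * x $ i) = (\<Sum>i\<in>UNIV. X i x * x $ i)"
      by (simp add: X_def sum_distrib_left power2_eq_square mult_ac)
    finally show ?thesis .
  qed
  have cX: "continuous_on (cball 0 1) (X i)" "continuous_on (cball 0 1) (pd i (X i))" for i
    by (intro smooth_on_cball_continuous smooth_on_cball_pd sX)+
  have cv: "continuous_on (cball 0 1) v" "continuous_on (cball 0 1) (grad v)"
    by (intro smooth_on_cball_continuous smooth_on_cball_grad_continuous v)+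
  have E1: "(LINT x:ball 0 1|lborel.
        (conorm2 G x (F x) + c_const CARD('n) * scalar_curvature G x * (w x)\<^sup>2) * vol_density G x)
      = (LINT x:ball 0 1|lborel. (norm (grad v x))\<^sup>2) - (LINT x:ball 0 1|lborel. \<Sum>i\<in>UNIV. pd i (X i) x)"
    (is "?L = _")
  proof -
    have "?L = (LINT x:ball 0 1|lborel. (norm (grad v x))\<^sup>2 - (\<Sum>i\<in>UNIV. pd i (X i) x))"
      by (rule set_lebesgue_integral_cong) (auto simp: inner)
    also have "\<dots> = (LINT x:ball 0 1|lborel. (norm (grad v x))\<^sup>2)
        - (LINT x:ball 0 1|lborel. \<Sum>i\<in>UNIV. pd i (X i) x)"
      by (rule set_integral_diff; rule ball_integrable) (auto intro!: continuous_intros cv cX)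
    finally show ?thesis .
  qed
  have E2: "b_const CARD('n) * (LINT x:sphere 0 1|sphere_measure. mean_curvature G x * (w x)\<^sup>2 * area_density G x)
      = b_const CARD('n) * (LINT x:sphere 0 1|sphere_measure. (v x)\<^sup>2)
        + (LINT x:sphere 0 1|sphere_measure. \<Sum>i\<in>UNIV. X i x * x $ i)" (is "?L = _")
  proof -
    have "?L = (LINT x:sphere 0 1|sphere_measure.
        b_const CARD('n) * (mean_curvature G x * (w x)\<^sup>2 * area_density G x))" by simp
    also have "\<dots> = (LINT x:sphere 0 1|sphere_measure.
        b_const CARD('n) * (v x)\<^sup>2 + (\<Sum>i\<in>UNIV. X i x * x $ i))"
      by (rule set_lebesgue_integral_cong) (auto simp: bdry)
    also have "\<dots> = (LINT x:sphere 0 1|sphere_measure. b_const CARD('n) * (v x)\<^sup>2)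
        + (LINT x:sphere 0 1|sphere_measure. \<Sum>i\<in>UNIV. X i x * x $ i)"
      by (rule set_integral_add; rule sphere_integrable)
        (auto intro!: continuous_intros continuous_on_subset[OF cv(1)] continuous_on_subset[OF cX(1)])
    finally show ?thesis by simp
  qed
  have B: "boundary_norm2 G w = (LINT x:sphere 0 1|sphere_measure. (v x)\<^sup>2 * u x powr \<beta>)"
    unfolding boundary_norm2_def
  proof (rule set_lebesgue_integral_cong)
    show "\<forall>x. x \<in> sphere 0 1 \<longrightarrow> (w x)\<^sup>2 * area_density G x = (v x)\<^sup>2 * u x powr \<beta>"
    proof (intro allI impI)
      fix x :: "real^'n" assume x: "x \<in> sphere 0 1"
      have nx: "norm x = 1" and xc: "x \<in> cball 0 1" and xU: "x \<in> U" using x U(2) by auto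
      show "(w x)\<^sup>2 * area_density G x = (v x)\<^sup>2 * u x powr \<beta>"
        unfolding area_density_G[OF nx] Wu[OF xU] using xc by (simp add: w_def power_mult_distrib)
    qed
  qed simp
  show ?thesis
  proof (rule that[OF _ _ B])
    show "H1_with_trace w F w"
      unfolding w_def F_def by (rule H1_with_trace_smooth[OF sW])
    show "energy G w F w = (LINT x:ball 0 1|lborel. (norm (grad v x))\<^sup>2)
      + b_const CARD('n) * (LINT x:sphere 0 1|sphere_measure. (v x)\<^sup>2)"
      unfolding energy_def E1 E2 divergence_ball[OF sX] by simp
  qed
qed

section \<open>Upper bounds for the normalised eigenvalue\<close>

lemma sigma1_le:
  assumes "H1_with_trace w F t" "boundary_norm2 G t \<noteq> 0"
  shows "sigma1 G \<le> ereal (energy G w F t / boundary_norm2 G t)"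
  unfolding sigma1_def using assms by (intro Inf_lower) blast

abbreviation sphere_area :: "'n::finite itself \<Rightarrow> real" where
  "sphere_area _ \<equiv> (LINT x:sphere (0::real^'n) 1|sphere_measure. 1)"

lemma sphere_area_pos: "sphere_area TYPE('n::finite) > 0"
  by (rule sphere_integral_pos) auto

context conformal_nhd
begin

definition \<rho> :: "real^'n \<Rightarrow> real" where "\<rho> x = u x powr \<beta>"

definition mass :: real where "mass = (LINT x:sphere 0 1|sphere_measure. \<rho> x)"

lemma \<rho>_smooth: "smooth_on_cball \<rho>"
  unfolding \<rho>_def[abs_def] by (rule smooth_on_cball_powr[OF conformal_factor])

lemma \<rho>_continuous: "continuous_on (cball 0 1) \<rho>"
  by (rule smooth_on_cball_continuous[OF \<rho>_smooth])

lemma \<rho>_pos: "x \<in> cball 0 1 \<Longrightarrow> \<rho> x > 0"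
  using pos[of x] U(2) by (auto simp: \<rho>_def)

lemma mass_pos: "mass > 0"
  unfolding mass_def using \<rho>_pos
  by (intro sphere_integral_pos continuous_on_subset[OF \<rho>_continuous]) auto

lemma normalized_sigma1_eq: "normalized_sigma1 u = sigma1 G * ereal mass"
  by (simp add: normalized_sigma1_def mass_def \<rho>_def \<beta>_def)

text \<open>The competitor is v / u. By conformal covariance its quotient is a Euclidean one in
  \<open>v\<close>, in which \<open>u\<close> is present only through the boundary weight
  \<open>\<rho>\<close>.\<close>

lemma normalized_sigma1_le:
  assumes v: "smooth_on_cball v"
    and B: "(LINT x:sphere 0 1|sphere_measure. (v x)\<^sup>2 * \<rho> x) \<noteq> 0"
  shows "normalized_sigma1 u \<le> ereal (((LINT x:ball 0 1|lborel. (norm (grad v x))\<^sup>2)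
      + b_const CARD('n) * (LINT x:sphere 0 1|sphere_measure. (v x)\<^sup>2))
      / (LINT x:sphere 0 1|sphere_measure. (v x)\<^sup>2 * \<rho> x) * mass)"
proof -
  obtain w F where w: "H1_with_trace w F w"
    "energy G w F w = (LINT x:ball 0 1|lborel. (norm (grad v x))\<^sup>2)
      + b_const CARD('n) * (LINT x:sphere 0 1|sphere_measure. (v x)\<^sup>2)"
    "boundary_norm2 G w = (LINT x:sphere 0 1|sphere_measure. (v x)\<^sup>2 * u x powr \<beta>)"
    by (rule test_function[OF v])
  have "sigma1 G \<le> ereal (energy G w F w / boundary_norm2 G w)"
    using B by (intro sigma1_le w(1)) (simp add: w(3) \<rho>_def)
  then have "sigma1 G * ereal mass \<le> ereal (energy G w F w / boundary_norm2 G w) * ereal mass"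
    using mass_pos by (intro ereal_mult_right_mono) auto
  then show ?thesis unfolding normalized_sigma1_eq w by (simp add: \<rho>_def)
qed

text \<open>For \<open>v = 1\<close> the boundary norm is \<open>mass\<close>, which is also the
  normalising factor; the two cancel and the bound is the same for all \<open>u\<close>.\<close>

lemma normalized_sigma1_le_area: "normalized_sigma1 u \<le> ereal (b_const CARD('n) * sphere_area TYPE('n))"
proof -
  have "grad (\<lambda>_. 1) x = 0" for x :: "real^'n" by (simp add: grad_def pd_const vec_eq_iff)
  then show ?thesis
    using normalized_sigma1_le[OF smooth_on_cball_const[of 1]] mass_pos
    by (simp add: mass_def[symmetric])
qed

text \<open>The first variation at the minimiser \<open>v = 1\<close> in the direction \<open>\<rho>\<close> gives the equality case of
  Cauchy-Schwarz for \<open>1\<close> and \<open>\<rho>\<close>.\<close>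

lemma rigidity_sphere:
  assumes eq: "normalized_sigma1 u = ereal (b_const CARD('n) * sphere_area TYPE('n))"
    and x: "x \<in> sphere 0 1"
  shows "\<rho> x = mass / sphere_area TYPE('n)"
proof -
  let ?A = "sphere_area TYPE('n)" and ?b = "b_const CARD('n)"
  define J2 where "J2 = (LINT x:sphere 0 1|sphere_measure. (\<rho> x)\<^sup>2)"
  define J3 where "J3 = (LINT x:sphere 0 1|sphere_measure. (\<rho> x)^3)"
  define I where "I = (LINT x:ball 0 1|lborel. (norm (grad \<rho> x))\<^sup>2)"
  have b: "?b > 0" using card by (simp add: b_const_def)
  have A: "?A > 0" by (rule sphere_area_pos)
  have cr: "continuous_on (sphere 0 1) \<rho>" by (rule continuous_on_subset[OF \<rho>_continuous]) auto
  have i: "set_integrable sphere_measure (sphere (0::real^'n) 1) (\<lambda>_. c::real)"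
    "set_integrable sphere_measure (sphere 0 1) (\<lambda>x. c * \<rho> x)"
    "set_integrable sphere_measure (sphere 0 1) (\<lambda>x. c * (\<rho> x)\<^sup>2)"
    "set_integrable sphere_measure (sphere 0 1) (\<lambda>x. c * (\<rho> x)^3)" for c
    by (intro sphere_integrable continuous_intros cr)+
  \<comment> \<open>All boundary integrals below are of polynomials of degree at most 3 in
    \<open>\<rho>\<close>.\<close>
  have quad: "(LINT x:sphere 0 1|sphere_measure. c0 + c1 * \<rho> x + c2 * (\<rho> x)\<^sup>2 + c3 * (\<rho> x)^3)
      = c0 * ?A + c1 * mass + c2 * J2 + c3 * J3" for c0 c1 c2 c3
  proof -
    have "(LINT x:sphere (0::real^'n) 1|sphere_measure. c0) = c0 * ?A"
      using set_integral_mult_right[where f="\<lambda>_. 1::real" and a=c0] by simp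
    then show ?thesis
      by (simp add: set_integral_add i mass_def J2_def J3_def)
  qed
  \<comment> \<open>Clear the denominator in the bound for \<open>v = 1 + s * \<rho>\<close>. The
    terms free of \<open>s\<close> cancel, and division by \<open>s\<close> leaves the first
    variation on the left.\<close>
  have key: "2 * ?b * (?A * J2 - mass\<^sup>2) \<le> s * (I * mass + ?b * J2 * mass - ?b * ?A * J3)" if s: "s > 0" for s
  proof -
    define v where "v = (\<lambda>x. 1 + s * \<rho> x)"
    have sv: "smooth_on_cball v"
      unfolding v_def by (intro smooth_on_cball_add smooth_on_cball_mult smooth_on_cball_const \<rho>_smooth)
    have V1: "(LINT x:sphere 0 1|sphere_measure. (v x)\<^sup>2) = ?A + 2 * s * mass + s\<^sup>2 * J2"
    proof -
      have "(v x)\<^sup>2 = 1 + (2 * s) * \<rho> x + s\<^sup>2 * (\<rho> x)\<^sup>2 + 0 * (\<rho> x)^3" for x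
        by (simp add: v_def power2_eq_square algebra_simps)
      then show ?thesis using quad[of 1 "2 * s" "s\<^sup>2" 0] by simp
    qed
    have V2: "(LINT x:sphere 0 1|sphere_measure. (v x)\<^sup>2 * \<rho> x) = mass + 2 * s * J2 + s\<^sup>2 * J3"
    proof -
      have "(v x)\<^sup>2 * \<rho> x = 0 + 1 * \<rho> x + (2 * s) * (\<rho> x)\<^sup>2 + s\<^sup>2 * (\<rho> x)^3" for x
        by (simp add: v_def power2_eq_square power3_eq_cube algebra_simps)
      then show ?thesis using quad[of 0 1 "2 * s" "s\<^sup>2"] by simp
    qed
    have V2pos: "(LINT x:sphere 0 1|sphere_measure. (v x)\<^sup>2 * \<rho> x) > 0"
    proof (rule sphere_integral_pos)
      show "continuous_on (sphere 0 1) (\<lambda>x. (v x)\<^sup>2 * \<rho> x)"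
        unfolding v_def by (intro continuous_intros cr)
      show "(v x)\<^sup>2 * \<rho> x > 0" if "x \<in> sphere 0 1" for x
      proof -
        have "\<rho> x > 0" using that \<rho>_pos by auto
        then have "v x > 0" using s by (simp add: v_def add_pos_pos)
        then show ?thesis using \<open>\<rho> x > 0\<close> by simp
      qed
    qed
    have V3: "(LINT x:ball 0 1|lborel. (norm (grad v x))\<^sup>2) = s\<^sup>2 * I"
    proof -
      have "(LINT x:ball 0 1|lborel. (norm (grad v x))\<^sup>2) = (LINT x:ball 0 1|lborel. s\<^sup>2 * (norm (grad \<rho> x))\<^sup>2)"
      proof (rule set_lebesgue_integral_cong)
        show "\<forall>x. x \<in> ball 0 1 \<longrightarrow> (norm (grad v x))\<^sup>2 = s\<^sup>2 * (norm (grad \<rho> x))\<^sup>2"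
        proof (intro allI impI)
          fix x :: "real^'n" assume "x \<in> ball 0 1"
          then have d: "\<rho> differentiable (at x)"
            by (intro smooth_on_cball_differentiable[OF \<rho>_smooth]) auto
          have "pd i v x = s * pd i \<rho> x" for i
            unfolding v_def
            by (subst pd_add) (auto simp: pd_const pd_cmult d intro!: derivative_intros d)
          then have "grad v x = s *\<^sub>R grad \<rho> x" by (simp add: grad_def vec_eq_iff)
          then show "(norm (grad v x))\<^sup>2 = s\<^sup>2 * (norm (grad \<rho> x))\<^sup>2"
            by (simp add: power_mult_distrib)
        qed
      qed simp
      then show ?thesis by (simp add: I_def)
    qed
    have "?b * ?A \<le> (s\<^sup>2 * I + ?b * (?A + 2 * s * mass + s\<^sup>2 * J2)) / (mass + 2 * s * J2 + s\<^sup>2 * J3) * mass"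
      using normalized_sigma1_le[OF sv] V2pos unfolding eq V1 V2 V3 by auto
    then have "?b * ?A * (mass + 2 * s * J2 + s\<^sup>2 * J3) \<le> (s\<^sup>2 * I + ?b * (?A + 2 * s * mass + s\<^sup>2 * J2)) * mass"
      using V2pos unfolding V2 by (simp add: pos_le_divide_eq)
    then have "s * (2 * ?b * (?A * J2 - mass\<^sup>2)) \<le> s * (s * (I * mass + ?b * J2 * mass - ?b * ?A * J3))"
      by (simp add: algebra_simps power2_eq_square)
    then show ?thesis using s by simp
  qed
  have "2 * ?b * (?A * J2 - mass\<^sup>2) \<le> 0"
  proof (rule tendsto_lowerbound)
    show "((\<lambda>s. s * (I * mass + ?b * J2 * mass - ?b * ?A * J3)) \<longlongrightarrow> 0) (at_right 0)"
      by (auto intro!: tendsto_eq_intros)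
    show "eventually (\<lambda>s. 2 * ?b * (?A * J2 - mass\<^sup>2) \<le> s * (I * mass + ?b * J2 * mass - ?b * ?A * J3)) (at_right 0)"
      using key by (auto simp: eventually_at_filter)
  qed simp
  then have J2: "?A * J2 \<le> mass\<^sup>2" using b by (simp add: mult_le_0_iff)
  \<comment> \<open>\<open>?m\<close> is the average of \<open>\<rho>\<close> over the sphere. The
    variance of \<open>\<rho>\<close> is nonpositive by \<open>J2\<close>, hence zero.\<close>
  let ?m = "mass / ?A"
  have "(LINT x:sphere 0 1|sphere_measure. (\<rho> x - ?m)\<^sup>2) = J2 - mass\<^sup>2 / ?A"
  proof -
    have "(\<rho> x - ?m)\<^sup>2 = ?m\<^sup>2 + (- 2 * ?m) * \<rho> x + 1 * (\<rho> x)\<^sup>2 + 0 * (\<rho> x)^3" for x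
      by (simp add: power2_eq_square algebra_simps)
    then have "(LINT x:sphere 0 1|sphere_measure. (\<rho> x - ?m)\<^sup>2) = ?m\<^sup>2 * ?A + (- 2 * ?m) * mass + J2"
      using quad[of "?m\<^sup>2" "- 2 * ?m" 1 0] by simp
    also have "\<dots> = J2 - mass\<^sup>2 / ?A"
    proof -
      have "(m / a)\<^sup>2 * a + (- 2 * (m / a)) * m + j = j - m\<^sup>2 / a" if "a > 0" for a m j :: real
        using that by (simp add: power2_eq_square field_simps)
      then show ?thesis using A .
    qed
    finally show ?thesis .
  qed
  moreover have "J2 - mass\<^sup>2 / ?A \<le> 0" using J2 A by (simp add: pos_le_divide_eq mult.commute)
  moreover have "(LINT x:sphere 0 1|sphere_measure. (\<rho> x - ?m)\<^sup>2) \<ge> 0"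
    unfolding set_lebesgue_integral_def by (rule integral_nonneg_AE) (auto simp: indicator_def)
  ultimately have "(LINT x:sphere 0 1|sphere_measure. (\<rho> x - ?m)\<^sup>2) = 0" by linarith
  moreover have "continuous_on (sphere 0 1) (\<lambda>x. (\<rho> x - ?m)\<^sup>2)"
    by (intro continuous_intros cr)
  ultimately have "(\<rho> x - ?m)\<^sup>2 = 0"
    using sphere_integral_zero_imp_zero[of "\<lambda>x. (\<rho> x - ?m)\<^sup>2" x] x by simp
  then show ?thesis by simp
qed

text \<open>Energy method: the field (u - \<kappa>) grad u vanishes on the sphere and,
  \<open>u\<close> being harmonic, has divergence |grad u|^2.\<close>

lemma harmonic_const:
  assumes h: "\<And>x. x \<in> ball 0 1 \<Longrightarrow> lap x = 0"
    and s: "\<And>x. x \<in> sphere 0 1 \<Longrightarrow> u x = \<kappa>" and x: "x \<in> cball 0 1"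
  shows "u x = \<kappa>"
proof -
  have su: "smooth_on_cball u" using conformal_factor by (simp add: conformal_factors_def)
  define X where "X i y = (u y + (- \<kappa>)) * pd i u y" for i y
  have sX: "smooth_on_cball (X i)" for i
    unfolding X_def[abs_def]
    by (intro smooth_on_cball_mult smooth_on_cball_add su smooth_on_cball_const smooth_on_cball_pd)
  have pX: "(\<Sum>i\<in>UNIV. pd i (X i) y) = (norm (grad u y))\<^sup>2" if y: "y \<in> ball 0 1" for y
  proof -
    have yc: "y \<in> cball 0 1" using y by auto
    have d: "u differentiable (at y)" "\<And>i. pd i u differentiable (at y)"
      using smooth_on_cball_differentiable[OF _ yc] su smooth_on_cball_pd by blast+
    have "pd i (X i) y = (u y - \<kappa>) * pd i (pd i u) y + (pd i u y)\<^sup>2" for i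
      unfolding X_def[abs_def] using d
      by (simp add: pd_mult pd_diff pd_const differentiable_diff power2_eq_square)
    then have "(\<Sum>i\<in>UNIV. pd i (X i) y) = (u y - \<kappa>) * lap y + (\<Sum>i\<in>UNIV. (pd i u y)\<^sup>2)"
      by (simp add: sum.distrib sum_distrib_left lap_def)
    then show ?thesis
      using h[OF y] by (simp add: norm_grad_sq)
  qed
  have cg: "continuous_on (cball 0 1) (grad u)" by (rule smooth_on_cball_grad_continuous[OF su])
  have "(LINT y:ball 0 1|lborel. (norm (grad u y))\<^sup>2) = (LINT y:ball 0 1|lborel. \<Sum>i\<in>UNIV. pd i (X i) y)"
    by (rule set_lebesgue_integral_cong) (auto simp: pX)
  also have "\<dots> = (LINT y:sphere 0 1|sphere_measure. \<Sum>i\<in>UNIV. X i y * y $ i)"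
    by (rule divergence_ball[OF sX])
  also have "\<dots> = (LINT y:sphere (0::real^'n) 1|sphere_measure. 0)"
    by (rule set_lebesgue_integral_cong) (auto simp: X_def s)
  finally have 0: "(LINT y:ball 0 1|lborel. (norm (grad u y))\<^sup>2) = 0" by simp
  have g0: "grad u y = 0" if "y \<in> ball 0 1" for y
  proof -
    have "(norm (grad u y))\<^sup>2 = 0"
    proof (rule set_integral_zero_imp_zero[OF open_ball _ _ _ 0 that])
      show "continuous_on (ball 0 1) (\<lambda>y. (norm (grad u y))\<^sup>2)"
        by (intro continuous_intros continuous_on_subset[OF cg]) auto
      show "set_integrable lborel (ball 0 1) (\<lambda>y. (norm (grad u y))\<^sup>2)"
        by (rule ball_integrable) (auto intro!: continuous_intros cg)
    qed simp
    then show ?thesis by simp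
  qed
  have "\<exists>c. \<forall>y\<in>ball 0 1. u y = c"
  proof (rule has_derivative_zero_constant)
    fix y :: "real^'n" assume y: "y \<in> ball 0 1"
    have "u differentiable (at y)" using y by (intro smooth_on_cball_differentiable[OF su]) auto
    from has_derivative_grad[OF this] have "(u has_derivative (\<lambda>h. 0)) (at y)"
      by (simp add: g0[OF y])
    then show "(u has_derivative (\<lambda>h. 0)) (at y within ball 0 1)"
      by (rule has_derivative_at_withinI)
  qed simp
  then obtain c where c: "\<And>y. y \<in> ball 0 1 \<Longrightarrow> u y = c" by blast
  \<comment> \<open>Continuity carries the constant to the sphere, where it is compared with
    \<open>\<kappa>\<close> at the point \<open>axis undefined 1\<close>.\<close>
  have cc: "u y = c" if "y \<in> cball 0 1" for y
    by (rule continuous_constant_on_closure[of "ball 0 1"])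
      (use c that smooth_on_cball_continuous[OF su] in auto)
  have "norm (axis undefined 1 :: real^'n) = 1" by simp
  then have "c = \<kappa>" using cc[of "axis undefined 1"] s[of "axis undefined 1"] by simp
  then show ?thesis using cc[OF x] by simp
qed

end

section \<open>The Euclidean metric as a maximiser, and rigidity\<close>

lemma conformal_nhd_exists:
  fixes u :: "real^'n::finite \<Rightarrow> real"
  assumes "CARD('n) \<ge> 3" "u \<in> conformal_factors"
  obtains U where "conformal_nhd u U"
proof -
  obtain U where "open U" "cball 0 1 \<subseteq> U" "\<And>k. Ck_on k U u" "\<And>x. x \<in> U \<Longrightarrow> u x > 0"
    using conformal_factor_nhd[OF assms(2)] by metis
  then show ?thesis using assms(1) by (intro that[of U]) (simp add: conformal_nhd_def)
qed

text \<open>For the factor 1 the scalar curvature is 0 and the mean curvature is 1. The energy of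
  every competitor is therefore a nonnegative interior integral plus b_n times its boundary norm,
  which gives the lower bound.\<close>

lemma normalized_sigma1_euclidean:
  assumes card: "CARD('n::finite) \<ge> 3"
  shows "normalized_sigma1 (\<lambda>_::real^'n. 1) = ereal (b_const CARD('n) * sphere_area TYPE('n))"
proof -
  interpret conformal_nhd "\<lambda>_::real^'n. 1" UNIV
    using card by unfold_locales (auto intro: Ck_on_const)
  have b: "b_const CARD('n) > 0" using card by (simp add: b_const_def)
  have pd1: "pd i (\<lambda>_. 1) = (\<lambda>_. 0)" for i :: 'n by (auto simp: pd_const)
  have R: "c_const CARD('n) * scalar_curvature G x = 0" for x
    using scalar_curvature_G[of x] by (simp add: lap_def pd1 pd_const)
  have H: "mean_curvature G x = 1" if "norm x = 1" for x
    using mean_curvature_G[OF that] b by (simp add: pd1)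
  have "ereal (b_const CARD('n)) \<le> sigma1 G"
    unfolding sigma1_def
  proof (rule Inf_greatest)
    fix z assume "z \<in> {ereal (energy G w F t / boundary_norm2 G t) |w F t.
        H1_with_trace w F t \<and> boundary_norm2 G t \<noteq> 0}"
    then obtain w F t where z: "z = ereal (energy G w F t / boundary_norm2 G t)"
      and n0: "boundary_norm2 G t \<noteq> 0" by blast
    have B: "boundary_norm2 G t = (LINT x:sphere 0 1|sphere_measure. (t x)\<^sup>2)"
      unfolding boundary_norm2_def
      by (rule set_lebesgue_integral_cong) (auto simp: area_density_G)
    have "(LINT x:sphere 0 1|sphere_measure. mean_curvature G x * (t x)\<^sup>2 * area_density G x)
        = (LINT x:sphere 0 1|sphere_measure. (t x)\<^sup>2)"
      by (rule set_lebesgue_integral_cong) (auto simp: area_density_G H)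
    moreover have "0 \<le> (LINT x:ball 0 1|lborel.
        (conorm2 G x (F x) + c_const CARD('n) * scalar_curvature G x * (w x)\<^sup>2) * vol_density G x)"
      unfolding set_lebesgue_integral_def R
      by (rule integral_nonneg_AE) (auto simp: indicator_def conorm2_G vol_density_G)
    ultimately have E: "energy G w F t \<ge> b_const CARD('n) * boundary_norm2 G t"
      by (simp add: energy_def B)
    have "boundary_norm2 G t \<ge> 0"
      unfolding B set_lebesgue_integral_def by (rule integral_nonneg_AE) (auto simp: indicator_def)
    then have "boundary_norm2 G t > 0" using n0 by simp
    then show "ereal (b_const CARD('n)) \<le> z" using E by (simp add: z pos_le_divide_eq)
  qed
  then have "ereal (b_const CARD('n)) * ereal mass \<le> sigma1 G * ereal mass"
    using mass_pos by (intro ereal_mult_right_mono) auto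
  moreover have "mass = sphere_area TYPE('n)" by (simp add: mass_def \<rho>_def)
  ultimately have "ereal (b_const CARD('n) * sphere_area TYPE('n)) \<le> normalized_sigma1 (\<lambda>_::real^'n. 1)"
    by (simp add: normalized_sigma1_eq)
  then show ?thesis using normalized_sigma1_le_area by (intro antisym)
qed

lemma sigma1_star_eq:
  assumes card: "CARD('n::finite) \<ge> 3"
  shows "sigma1_star TYPE('n) = ereal (b_const CARD('n) * sphere_area TYPE('n))"
  unfolding sigma1_star_def
proof (rule antisym)
  show "(SUP u\<in>(conformal_factors :: (real^'n \<Rightarrow> real) set). normalized_sigma1 u)
      \<le> ereal (b_const CARD('n) * sphere_area TYPE('n))"
  proof (rule SUP_least)
    fix u :: "real^'n \<Rightarrow> real" assume "u \<in> conformal_factors"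
    then obtain U where "conformal_nhd u U" using conformal_nhd_exists[OF card] by blast
    then show "normalized_sigma1 u \<le> ereal (b_const CARD('n) * sphere_area TYPE('n))"
      by (rule conformal_nhd.normalized_sigma1_le_area)
  qed
  have "(\<lambda>_::real^'n. 1) \<in> conformal_factors"
    by (auto simp: conformal_factors_def smooth_on_cball_const)
  then show "ereal (b_const CARD('n) * sphere_area TYPE('n))
      \<le> (SUP u\<in>(conformal_factors :: (real^'n \<Rightarrow> real) set). normalized_sigma1 u)"
    by (rule SUP_upper2) (simp add: normalized_sigma1_euclidean[OF card])
qed

text \<open>The bounds of \<open>normalized_sigma1_le\<close> do not change when \<open>u\<close> is
  changed inside the ball only, so equality is exploited on the sphere. Inside, the conclusion is
  drawn for vanishing scalar curvature, which makes \<open>u\<close> harmonic.\<close>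

theorem theorem4p11:
  assumes "CARD('n::finite) \<ge> 3"
  shows "sigma1_star TYPE('n) = normalized_sigma1 (\<lambda>_::real^'n. 1) \<and>
    (\<forall>u::real^'n \<Rightarrow> real. u \<in> conformal_factors \<longrightarrow>
       sigma1_star TYPE('n) = normalized_sigma1 u \<longrightarrow>
       (\<exists>c>0. (\<forall>x\<in>sphere 0 1. conformal_metric u x = c *\<^sub>R flat_metric x) \<and>
          ((\<forall>x\<in>ball 0 1. scalar_curvature (conformal_metric u) x = 0) \<longrightarrow>
             (\<forall>x\<in>cball 0 1. conformal_metric u x = c *\<^sub>R flat_metric x))))"
proof (intro conjI allI impI)
  show "sigma1_star TYPE('n) = normalized_sigma1 (\<lambda>_::real^'n. 1)"
    by (simp only: sigma1_star_eq[OF assms] normalized_sigma1_euclidean[OF assms])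
  fix u :: "real^'n \<Rightarrow> real"
  assume u: "u \<in> conformal_factors" and eq: "sigma1_star TYPE('n) = normalized_sigma1 u"
  obtain U where "conformal_nhd u U" using conformal_nhd_exists[OF assms u] .
  then interpret conformal_nhd u U .
  define m where "m = mass / sphere_area TYPE('n)"
  \<comment> \<open>The boundary value of \<open>u\<close>, recovered from the constant value
    \<open>m\<close> of \<open>u powr \<beta>\<close>.\<close>
  define \<kappa> where "\<kappa> = m powr (1 / \<beta>)"
  have m: "m > 0" using mass_pos sphere_area_pos[where 'n='n] by (simp add: m_def)
  have u\<kappa>: "u x = \<kappa>" if "x \<in> sphere 0 1" for x
  proof -
    have "u x > 0" using that U(2) by (intro pos) auto
    moreover have "u x powr \<beta> = m"
      using rigidity_sphere[OF _ that] eq sigma1_star_eq[OF assms] by (simp add: \<rho>_def m_def)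
    ultimately show ?thesis using \<beta>_pos by (auto simp: \<kappa>_def powr_powr)
  qed
  show "\<exists>c>0. (\<forall>x\<in>sphere 0 1. G x = c *\<^sub>R flat_metric x) \<and>
      ((\<forall>x\<in>ball 0 1. scalar_curvature G x = 0) \<longrightarrow> (\<forall>x\<in>cball 0 1. G x = c *\<^sub>R flat_metric x))"
  proof (intro exI[of _ "\<kappa> powr (2 * \<beta>)"] conjI impI ballI)
    show "\<kappa> powr (2 * \<beta>) > 0" using m by (simp add: \<kappa>_def)
    show "G x = (\<kappa> powr (2 * \<beta>)) *\<^sub>R flat_metric x" if "x \<in> sphere 0 1" for x
      using u\<kappa>[OF that] by (simp add: G_eq flat_metric_def)
    fix x :: "real^'n"
    assume R: "\<forall>x\<in>ball 0 1. scalar_curvature G x = 0" and x: "x \<in> cball 0 1"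
    \<comment> \<open>In the formula for the scalar curvature the Laplacian is multiplied by a
      positive power of \<open>u\<close>.\<close>
    have "lap y = 0" if "y \<in> ball 0 1" for y
    proof -
      have yU: "y \<in> U" using that U(2) by auto
      show ?thesis using scalar_curvature_G[OF yU] R that pos[OF yU] by simp
    qed
    then have "u x = \<kappa>" using u\<kappa> x by (rule harmonic_const)
    then show "G x = (\<kappa> powr (2 * \<beta>)) *\<^sub>R flat_metric x" by (simp add: G_eq flat_metric_def)
  qed
qed

end
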